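(* Assume the weight $a\in(\mathbb C^\times)^n$ is generic. Then $$\mathrm{Spect}_{\mathcal A,a}=\pi_{L_{Y,a}}^{-1}(\mathbb C^n\setminus\Delta),$$ where $\mathrm{Spect}_{\mathcal A,a}=\{(x,y)\in(\mathbb C^n\setminus\Delta)\times(\mathbb C^n)^*:\ \exists\,v\in\mathrm{Sing}_aV,\ v\neq0,\ K_j(x)v=y_jv\ \text{for all } j\in J\}$.
   Context: Let $0<k<n$, $J=\{1,\dots,n\}$. On $\mathbb C^k$ (coordinates $t$) fix nonzero linear functions $g_j=b^1_jt_1+\dots+b^k_jt_k$, $j\in J$, spanning $(\mathbb C^k)^*$. A subset of $J$ is independent if the corresponding $g_i$ are linearly independent. Circuits: $C\subset J$ with $(g_i)_{i\in C}$ dependent but every proper subset independent. For each circuit $C$ fix a nonzero $(\lambda^C_i)_{i\in J}$, $\lambda^C_i=0$ for $i\notin C$, with $\sum_i\lambda^C_ig_i=0$, and $f_C(z)=\sum_i\lambda^C_iz_i$. Discriminant $\Delta=\bigcup_C\{f_C=0\}\subset\mathbb C^n$. The space $V$: the vector space with basis $F_{j_1,\dots,j_k}$ indexed by independent $k$-subsets $\{j_1<\dots<j_k\}$, extended to all ordered $k$-tuples by skew-symmetry $F_{j_{\sigma(1)},\dots,j_{\sigma(k)}}=(-1)^{|\sigma|}F_{j_1,\dots,j_k}$ and by $F_{j_1,\dots,j_k}=0$ for dependent tuples. $\mathrm{Sing}_aV$ is the subspace of $\sum c_{j_1,\dots,j_k}F_{j_1,\dots,j_k}$ (coefficients $c$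 extended skew-symmetrically, $0$ on dependent tuples) such that $\sum_{j\in J}a_jc_{j,i_2,\dots,i_k}=0$ for every independent $(k-1)$-subset $\{i_2,\dots,i_k\}$. For a circuit $C$ listed as $i_1,\dots,i_r$ and $C_m=C\setminus\{i_m\}$, the operator $L_C:V\to V$ is: $L_C(F_{j_1,\dots,j_k})=0$ if $|\{j_1,\dots,j_k\}\cap C|<r-1$; if $\{j_1,\dots,j_k\}\cap C=C_m$, write $F_{j_1,\dots,j_k}=\pm F_{i_1,\dots,\widehat{i_m},\dots,i_r,s_1,\dots,s_{k-r+1}}$ with $\{s_\ell\}=\{j_1,\dots,j_k\}\setminus C_m$ and set $L_C(F_{i_1,\dots,\widehat{i_m},\dots,i_r,s_1,\dots,s_{k-r+1}})=(-1)^m\sum_{l=1}^r(-1)^la_{i_l}F_{i_1,\dots,\widehat{i_l},\dots,i_r,s_1,\dots,s_{k-r+1}}$. For $x\in\mathbb C^n\setminus\Delta$, $K_j(x)=\sum_C\frac{\lambda^C_j}{f_C(x)}L_C$ (sum over circuits); these operators preserve $\mathrm{Sing}_aV$ and are the coefficients of the Gauss–Manin equations $\kappa\,\partial I/\partial z_j=K_jI$. $Y\subset\mathbb C^n$ is spanned by $b^i=(b^i_1,\dots,b^i_n)$, $i=1,\dots,k$; $\mathbb C^n$ has coordinates $q_j$ and $(\mathbb C^n)^*$ dual coordinates $p_j$; $Y^\perp$ is the annihilator of $Y$. $L_{Y,a}=r_a(Y\times Y^\perp)$, with $r_a(q,p)=(q_1+a_1/p_1,\dots,q_n+a_n/p_n,p)$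 applied to points with all $p_j\ne0$; $\pi_{L_{Y,a}}:L_{Y,a}\to\mathbb C^n$ is the projection $(q,p)\mapsto q$. "Generic" means outside a proper Zariski-closed subset of $(\mathbb C^\times)^n$. *)

theory Defs
  imports "HOL-Analysis.Analysis"
begin

text \<open>Index set J = {0..<n} (0-based).  Points of C^n and (C^n)^* are functions
  nat => complex vanishing outside {0..<n}.  The linear forms g_j live in complex^'k,
  k = CARD('k); the coefficient b^i_j is g j $ i.\<close>

definition Cn :: "nat \<Rightarrow> (nat \<Rightarrow> complex) set" where
  "Cn n = {x. \<forall>j\<ge>n. x j = 0}"

definition torus :: "nat \<Rightarrow> (nat \<Rightarrow> complex) set" where
  "torus n = {a \<in> Cn n. \<forall>j<n. a j \<noteq> 0}"

definition indep :: "(nat \<Rightarrow> complex^'k) \<Rightarrow> nat set \<Rightarrow> bool" where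
  "indep g S \<longleftrightarrow> (\<forall>c. (\<Sum>i\<in>S. c i *s g i) = 0 \<longrightarrow> (\<forall>i\<in>S. c i = 0))"

definition circuit :: "nat \<Rightarrow> (nat \<Rightarrow> complex^'k) \<Rightarrow> nat set \<Rightarrow> bool" where
  "circuit n g C \<longleftrightarrow> C \<subseteq> {..<n} \<and> \<not> indep g C \<and> (\<forall>D. D \<subset> C \<longrightarrow> indep g D)"

definition indepK :: "nat \<Rightarrow> (nat \<Rightarrow> complex^'k) \<Rightarrow> nat set set" where
  "indepK n g = {S. S \<subseteq> {..<n} \<and> card S = CARD('k) \<and> indep g S}"

definition inv_count :: "nat list \<Rightarrow> nat" where
  "inv_count xs = card {(i,j). i < j \<and> j < length xs \<and> xs ! j < xs ! i}"

definition lsign :: "nat list \<Rightarrow> complex" where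
  "lsign xs = (-1) ^ inv_count xs"

text \<open>Elements of V are coefficient functions on the basis F_S, S an independent k-subset.\<close>
definition Vsp :: "nat \<Rightarrow> (nat \<Rightarrow> complex^'k) \<Rightarrow> (nat set \<Rightarrow> complex) set" where
  "Vsp n g = {v. \<forall>S. v S \<noteq> 0 \<longrightarrow> S \<in> indepK n g}"

definition Fvec :: "nat \<Rightarrow> (nat \<Rightarrow> complex^'k) \<Rightarrow> nat list \<Rightarrow> nat set \<Rightarrow> complex" where
  "Fvec n g ts = (if length ts = CARD('k) \<and> distinct ts \<and> set ts \<in> indepK n g
     then (\<lambda>S. if S = set ts then lsign ts else 0) else (\<lambda>S. 0))"

definition coef :: "nat \<Rightarrow> (nat \<Rightarrow> complex^'k) \<Rightarrow> (nat set \<Rightarrow> complex) \<Rightarrow> nat list \<Rightarrow> complex" where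
  "coef n g v ts = (if length ts = CARD('k) \<and> distinct ts \<and> set ts \<in> indepK n g
     then lsign ts * v (set ts) else 0)"

definition SingV :: "nat \<Rightarrow> (nat \<Rightarrow> complex^'k) \<Rightarrow> (nat \<Rightarrow> complex) \<Rightarrow> (nat set \<Rightarrow> complex) set" where
  "SingV n g a = {v \<in> Vsp n g. \<forall>T. T \<subseteq> {..<n} \<and> card T = CARD('k) - 1 \<and> indep g T \<longrightarrow>
      (\<Sum>j<n. a j * coef n g v (j # sorted_list_of_set T)) = 0}"

definition ldel :: "nat \<Rightarrow> 'a list \<Rightarrow> 'a list" where
  "ldel m xs = take m xs @ drop (Suc m) xs"

text \<open>L_C(F_S) for S an independent k-subset; C listed increasingly as i_1<...<i_r
  (position m here is 0-based, so the paper's (-1)^m is (-1)^(m+1)).\<close>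
definition LC_basis :: "nat \<Rightarrow> (nat \<Rightarrow> complex^'k) \<Rightarrow> (nat \<Rightarrow> complex) \<Rightarrow> nat set \<Rightarrow> nat set
    \<Rightarrow> nat set \<Rightarrow> complex" where
  "LC_basis n g a C S =
    (let cl = sorted_list_of_set C; r = length cl; sl = sorted_list_of_set (S - C) in
     if \<exists>m<r. S \<inter> C = C - {cl ! m} then
       (let m = (THE m. m < r \<and> S \<inter> C = C - {cl ! m}); tm = ldel m cl @ sl in
        (\<lambda>U. lsign tm * (-1) ^ (m + 1) *
              (\<Sum>l<r. (-1) ^ (l + 1) * a (cl ! l) * Fvec n g (ldel l cl @ sl) U)))
     else (\<lambda>U. 0))"

definition LC :: "nat \<Rightarrow> (nat \<Rightarrow> complex^'k) \<Rightarrow> (nat \<Rightarrow> complex) \<Rightarrow> nat set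
    \<Rightarrow> (nat set \<Rightarrow> complex) \<Rightarrow> nat set \<Rightarrow> complex" where
  "LC n g a C v = (\<lambda>U. \<Sum>S\<in>indepK n g. v S * LC_basis n g a C S U)"

definition fC :: "(nat set \<Rightarrow> nat \<Rightarrow> complex) \<Rightarrow> nat \<Rightarrow> nat set \<Rightarrow> (nat \<Rightarrow> complex) \<Rightarrow> complex" where
  "fC lam n C x = (\<Sum>i<n. lam C i * x i)"

definition Kop :: "nat \<Rightarrow> (nat \<Rightarrow> complex^'k) \<Rightarrow> (nat set \<Rightarrow> nat \<Rightarrow> complex) \<Rightarrow> (nat \<Rightarrow> complex)
    \<Rightarrow> nat \<Rightarrow> (nat \<Rightarrow> complex) \<Rightarrow> (nat set \<Rightarrow> complex) \<Rightarrow> nat set \<Rightarrow> complex" where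
  "Kop n g lam a j x v = (\<lambda>U. \<Sum>C\<in>{C. circuit n g C}. lam C j / fC lam n C x * LC n g a C v U)"

definition Delta :: "nat \<Rightarrow> (nat \<Rightarrow> complex^'k) \<Rightarrow> (nat set \<Rightarrow> nat \<Rightarrow> complex) \<Rightarrow> (nat \<Rightarrow> complex) set" where
  "Delta n g lam = {x \<in> Cn n. \<exists>C. circuit n g C \<and> fC lam n C x = 0}"

definition Spect :: "nat \<Rightarrow> (nat \<Rightarrow> complex^'k) \<Rightarrow> (nat set \<Rightarrow> nat \<Rightarrow> complex) \<Rightarrow> (nat \<Rightarrow> complex)
    \<Rightarrow> ((nat \<Rightarrow> complex) \<times> (nat \<Rightarrow> complex)) set" where
  "Spect n g lam a = {(x, y). x \<in> Cn n - Delta n g lam \<and> y \<in> Cn n \<and>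
     (\<exists>v\<in>SingV n g a. v \<noteq> (\<lambda>S. 0) \<and> (\<forall>j<n. Kop n g lam a j x v = (\<lambda>U. y j * v U)))}"

definition Ysp :: "nat \<Rightarrow> (nat \<Rightarrow> complex^'k) \<Rightarrow> (nat \<Rightarrow> complex) set" where
  "Ysp n g = {q \<in> Cn n. \<exists>t::complex^'k. \<forall>j<n. q j = (\<Sum>i\<in>UNIV. t $ i * g j $ i)}"

definition Yperp :: "nat \<Rightarrow> (nat \<Rightarrow> complex^'k) \<Rightarrow> (nat \<Rightarrow> complex) set" where
  "Yperp n g = {p \<in> Cn n. \<forall>q\<in>Ysp n g. (\<Sum>j<n. p j * q j) = 0}"

definition ra :: "nat \<Rightarrow> (nat \<Rightarrow> complex) \<Rightarrow> (nat \<Rightarrow> complex) \<times> (nat \<Rightarrow> complex)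
    \<Rightarrow> (nat \<Rightarrow> complex) \<times> (nat \<Rightarrow> complex)" where
  "ra n a qp = ((\<lambda>j. if j < n then fst qp j + a j / snd qp j else 0), snd qp)"

definition LYa :: "nat \<Rightarrow> (nat \<Rightarrow> complex^'k) \<Rightarrow> (nat \<Rightarrow> complex)
    \<Rightarrow> ((nat \<Rightarrow> complex) \<times> (nat \<Rightarrow> complex)) set" where
  "LYa n g a = ra n a ` {(q, p). q \<in> Ysp n g \<and> p \<in> Yperp n g \<and> (\<forall>j<n. p j \<noteq> 0)}"

inductive_set poly_funs :: "nat \<Rightarrow> ((nat \<Rightarrow> complex) \<Rightarrow> complex) set" for n where
  pf_const: "(\<lambda>a. c) \<in> poly_funs n"
| pf_var: "j < n \<Longrightarrow> (\<lambda>a. a j) \<in> poly_funs n"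
| pf_add: "P \<in> poly_funs n \<Longrightarrow> Q \<in> poly_funs n \<Longrightarrow> (\<lambda>a. P a + Q a) \<in> poly_funs n"
| pf_mult: "P \<in> poly_funs n \<Longrightarrow> Q \<in> poly_funs n \<Longrightarrow> (\<lambda>a. P a * Q a) \<in> poly_funs n"

end

theory Submission
  imports Defs
begin

text \<open>
  Write \<open>c\<close> for the skew-symmetric coefficients of \<open>v\<close>, \<open>us[u := i]\<close> for the tuple \<open>us\<close> with the
  entry \<open>u\<close> replaced by \<open>i\<close>, and \<open>R(us, i) = c(us) - \<Sum>\<^sub>u c(us[u := i])\<close>.  For a basis \<open>U\<close>, listed
  by \<open>us\<close>, and \<open>i\<close> outside \<open>U\<close>, let \<open>C\<close> be the fundamental circuit of \<open>i\<close>.  The \<open>U\<close>-coefficient of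
  \<open>L\<^sub>C v\<close> is \<open>a\<^sub>i R(us, i)\<close>.  Hence the eigenvalue equations give
  \<open>\<lambda>\<^sub>i a\<^sub>i R(us, i) = f\<^sub>C(x) y\<^sub>i c(us)\<close> and, since \<open>C\<close> is also fundamental for \<open>us[u := i]\<close>,
  \<open>\<lambda>\<^sub>u a\<^sub>u R(us, i) = - f\<^sub>C(x) y\<^sub>u c(us[u := i])\<close>.  If no \<open>y\<^sub>j\<close> vanishes, dividing by \<open>y\<close> and adding
  these equations yields \<open>f\<^sub>C(a/y) = f\<^sub>C(x)\<close> for all fundamental circuits of one basis, that is,
  \<open>x - a/y \<in> Y\<close>; and \<open>y\<close> annihilates \<open>Y\<close> because \<open>\<Sum>\<^sub>j K\<^sub>j g\<^sub>j = 0\<close>.  A vanishing \<open>y\<^sub>j\<close> is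
  excluded for singular vectors as soon as \<open>\<Sum>\<^sub>j\<^sub>\<in>\<^sub>Z a\<^sub>j \<noteq> 0\<close> for all nonempty \<open>Z \<subseteq> J\<close>; this is the
  genericity condition.  Conversely, a point of the Lagrangian variety over \<open>x\<close> is a critical point
  of the master function, and \<open>v\<^sub>U = det(g\<^sub>U) / \<Prod>\<^sub>u f\<^sub>u\<close> is an eigenvector by Cramer's rule.
\<close>

subsection \<open>Signs and alternating functions of tuples\<close>

text \<open>Adjacent transpositions generate all permutations, so this is full skew-symmetry;
  repeated entries then force the value 0.\<close>

definition alternating :: "('b list \<Rightarrow> complex) \<Rightarrow> bool" where
  "alternating A \<longleftrightarrow> (\<forall>xs a b ys. A (xs @ b # a # ys) = - A (xs @ a # b # ys))"

lemma alternating_move: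
  assumes "alternating A"
  shows "A (xs @ a # ys @ zs) = (-1) ^ length ys * A (xs @ ys @ a # zs)"
proof (induction ys arbitrary: xs)
  case (Cons b ys)
  have "A (xs @ a # b # ys @ zs) = - A (xs @ b # a # ys @ zs)"
    using assms unfolding alternating_def by blast
  then show ?case using Cons[of "xs @ [b]"] by simp
qed simp

lemma alternating_swap:
  assumes "alternating A"
  shows "A (xs @ b # ys @ a # zs) = - A (xs @ a # ys @ b # zs)"
proof -
  have "A (xs @ b # ys @ a # zs) = (-1) ^ length ys * A ((xs @ ys) @ b # a # zs)"
    using alternating_move[OF assms, of xs b ys "a # zs"] by simp
  also have "A ((xs @ ys) @ b # a # zs) = - A ((xs @ ys) @ a # b # zs)"
    using assms unfolding alternating_def by blast
  also have "(-1) ^ length ys * - A ((xs @ ys) @ a # b # zs) = - A (xs @ a # ys @ b # zs)"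
    using alternating_move[OF assms, of xs a ys "b # zs"] by simp
  finally show ?thesis .
qed

text \<open>An inversion either involves the head position, counted by the entries below
  \<open>x\<close>, or is an inversion of \<open>xs\<close> with both positions shifted by
  one.\<close>

lemma inv_count_Cons:
  "inv_count (x # xs) = length (filter (\<lambda>y. y < x) xs) + inv_count xs"
proof -
  let ?A = "(\<lambda>j. (0::nat, Suc j)) ` {j. j < length xs \<and> xs ! j < x}"
  let ?I = "{(i, j). i < j \<and> j < length xs \<and> xs ! j < xs ! i}"
  let ?B = "map_prod Suc Suc ` ?I"
  have "?I \<subseteq> {..<length xs} \<times> {..<length xs}" by auto
  then have fin: "finite ?I" by (rule finite_subset) simp
  have "(i, j) \<in> {(i, j). i < j \<and> j < length (x # xs) \<and> (x # xs) ! j < (x # xs) ! i}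
      \<longleftrightarrow> (i, j) \<in> ?A \<union> ?B" for i j
    by (cases i; cases j) (auto simp: image_iff)
  then have eq: "{(i, j). i < j \<and> j < length (x # xs) \<and> (x # xs) ! j < (x # xs) ! i} = ?A \<union> ?B"
    by auto
  have "card (?A \<union> ?B) = card ?A + card ?B"
    by (rule card_Un_disjoint) (use fin in auto)
  moreover have "card ?A = length (filter (\<lambda>y. y < x) xs)"
    by (subst card_image) (auto simp: inj_on_def length_filter_conv_card)
  moreover have "card ?B = inv_count xs"
    unfolding inv_count_def by (subst card_image) (auto simp: inj_on_def)
  ultimately show ?thesis unfolding inv_count_def[of "x # xs"] eq by simp
qed

lemma lsign_Cons: "lsign (x # xs) = (-1) ^ length (filter (\<lambda>y. y < x) xs) * lsign xs"
  by (simp add: lsign_def inv_count_Cons power_add)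

lemma lsign_square: "lsign xs * lsign xs = 1"
  by (simp add: lsign_def flip: power_add)

lemma lsign_adjacent: "a \<noteq> b \<Longrightarrow> lsign (xs @ b # a # ys) = - lsign (xs @ a # b # ys)"
  by (induction xs) (auto simp: lsign_Cons)

text \<open>Both factors change sign when adjacent distinct entries are exchanged, so
  \<open>lsign us * A us\<close> depends only on the set of entries. Identities between alternating
  functions can therefore be checked on any convenient listing of a basis.\<close>

lemma lsign_alternating_eq:
  assumes alt: "alternating A" and "distinct us" "distinct vs" "set us = set vs"
  shows "lsign us * A us = lsign vs * A vs"
proof -
  define G where "G zs = lsign zs * A zs" for zs
  have adj: "G (xs @ b # a # ys) = G (xs @ a # b # ys)" if "a \<noteq> b" for xs a b ys
  proof -
    have "A (xs @ b # a # ys) = - A (xs @ a # b # ys)" using alt unfolding alternating_def by blast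
    then show ?thesis unfolding G_def lsign_adjacent[OF that, of xs ys] by (simp only: minus_mult_minus)
  qed
  have move: "G (xs @ ys @ a # zs) = G (xs @ a # ys @ zs)" if "a \<notin> set ys" for xs a ys zs
    using that
  proof (induction ys arbitrary: xs)
    case (Cons b ys)
    have "G (xs @ (b # ys) @ a # zs) = G ((xs @ [b]) @ a # ys @ zs)"
      using Cons.IH[of "xs @ [b]"] Cons.prems by simp
    also have "\<dots> = G (xs @ a # b # ys @ zs)"
      using adj[of a b xs "ys @ zs"] Cons.prems by simp
    finally show ?case by simp
  qed simp
  \<comment> \<open>The head of \<open>us\<close> is brought to the front of \<open>vs\<close>;
    \<open>pre\<close> collects the entries already matched.\<close>
  have "G (pre @ us) = G (pre @ vs)" if "distinct us" "mset us = mset vs" for pre us vs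
    using that
  proof (induction us arbitrary: pre vs)
    case (Cons u us)
    then have "u \<in> set vs" by (metis list.set_intros(1) set_mset_mset)
    then obtain p q where vs: "vs = p @ u # q" by (meson split_list)
    have "distinct vs" using Cons.prems by (metis mset_eq_imp_distinct_iff)
    then have "G (pre @ vs) = G ((pre @ [u]) @ p @ q)" using move[of u p pre q] vs by simp
    also have "\<dots> = G ((pre @ [u]) @ us)"
      using Cons.IH[of "p @ q" "pre @ [u]"] Cons.prems vs by simp
    finally show ?case by simp
  qed simp
  from this[of us vs "[]"] show ?thesis
    using assms unfolding G_def by (simp add: set_eq_iff_mset_eq_distinct)
qed

lemma alternating_coef: "alternating (coef n g v)"
  unfolding alternating_def
proof (intro allI)
  fix xs ys :: "nat list" and a b :: nat
  show "coef n g v (xs @ b # a # ys) = - coef n g v (xs @ a # b # ys)"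
  proof (cases "a = b")
    case False
    have "set (xs @ b # a # ys) = set (xs @ a # b # ys)" by auto
    then show ?thesis using False lsign_adjacent[OF False, of xs ys] unfolding coef_def by auto
  qed (simp add: coef_def)
qed

text \<open>For alternating \<open>A\<close> this is the simplicial coboundary of \<open>A\<close> at \<open>i # us\<close>; writing it with
  exchanges instead of omissions avoids position signs.\<close>

definition exch :: "(nat list \<Rightarrow> complex) \<Rightarrow> nat list \<Rightarrow> nat \<Rightarrow> complex" where
  "exch A us i = A us - (\<Sum>u\<in>set us. A (map (id(u := i)) us))"

lemma map_upd_notin: "u \<notin> set xs \<Longrightarrow> map (id(u := i)) xs = xs"
  by (rule map_idI) auto

lemma alternating_exch:
  assumes "alternating A"
  shows "alternating (\<lambda>us. exch A us i)"
  unfolding alternating_def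
proof (intro allI)
  fix xs ys :: "nat list" and a b :: nat
  have eq: "set (xs @ b # a # ys) = set (xs @ a # b # ys)" by auto
  have "A (xs @ b # a # ys) = - A (xs @ a # b # ys)" for xs a b ys
    using assms unfolding alternating_def by blast
  note this[of xs b a ys] this[of "map f xs" "f b" "f a" "map f ys" for f]
  then show "exch A (xs @ b # a # ys) i = - exch A (xs @ a # b # ys) i"
    unfolding exch_def eq by (simp only: list.map map_append sum_negf minus_diff_eq) simp
qed

text \<open>In the coboundary the entries of \<open>i # us\<close> play symmetric roles, and here
  \<open>i\<close> and \<open>u\<close> trade places. Replacing \<open>i\<close> by \<open>u\<close>
  in the new tuple gives back \<open>us\<close>; replacing another entry \<open>w\<close> by
  \<open>u\<close> gives \<open>us\<close> with \<open>w\<close> replaced by \<open>i\<close>, up to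
  a transposition of \<open>u\<close> and \<open>i\<close>.\<close>

lemma exch_swap:
  assumes alt: "alternating A" and dist: "distinct us" and u: "u \<in> set us" and i: "i \<notin> set us"
  shows "exch A (map (id(u := i)) us) u = - exch A us i"
proof -
  obtain p q where us: "us = p @ u # q" using u by (meson split_list)
  have pq: "u \<notin> set p" "u \<notin> set q" "i \<notin> set p" "i \<notin> set q" "u \<noteq> i" "set p \<inter> set q = {}"
    "distinct p" "distinct q"
    using dist i us by auto
  have us': "map (id(u := i)) us = p @ i # q"
    unfolding us using pq by (simp add: map_upd_notin)
  have w: "A (map (id(w := u)) (p @ i # q)) = - A (map (id(w := i)) us)" if w: "w \<in> set p \<union> set q" for w
  proof (cases "w \<in> set p")
    case True
    then obtain p1 p2 where p: "p = p1 @ w # p2" by (meson split_list)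
    have "w \<notin> set p1" "w \<notin> set p2" "w \<notin> set q" "w \<noteq> i" "w \<noteq> u" using pq p by auto
    then show ?thesis
      using alternating_swap[OF alt, of p1 u p2 i q] unfolding us p by (simp add: map_upd_notin)
  next
    case False
    then have "w \<in> set q" using w by blast
    then obtain p1 p2 where p: "q = p1 @ w # p2" by (meson split_list)
    have "w \<notin> set p1" "w \<notin> set p2" "w \<notin> set p" "w \<noteq> i" "w \<noteq> u" using pq p False by auto
    then show ?thesis
      using alternating_swap[OF alt, of p i p1 u p2] unfolding us p by (simp add: map_upd_notin)
  qed
  have s1: "set (p @ i # q) = insert i (set p \<union> set q)" and s2: "set us = insert u (set p \<union> set q)"
    unfolding us by auto
  have "exch A (p @ i # q) u = A (p @ i # q) - A us - (\<Sum>w\<in>set p \<union> set q. A (map (id(w := u)) (p @ i # q)))"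
    unfolding exch_def s1 using pq by (simp add: map_upd_notin us)
  also have "\<dots> = A (p @ i # q) - A us + (\<Sum>w\<in>set p \<union> set q. A (map (id(w := i)) us))"
    using w by (simp add: sum_negf)
  also have "\<dots> = - exch A us i"
    unfolding exch_def s2 using pq us' by simp
  finally show ?thesis unfolding us' .
qed

subsection \<open>Determinants of tuples of vectors\<close>

text \<open>An arbitrary enumeration of the index type turns list positions into matrix rows;
  another choice would change \<open>ldet\<close> only by a global sign.\<close>

definition idx :: "'k::finite \<Rightarrow> nat" where
  "idx = (SOME f. bij_betw f UNIV {..<CARD('k)})"

lemma bij_idx: "bij_betw (idx :: 'k::finite \<Rightarrow> nat) UNIV {..<CARD('k)}"
proof -
  have "\<exists>f. bij_betw f (UNIV :: 'k set) {..<CARD('k)}"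
    using ex_bij_betw_finite_nat[of "UNIV :: 'k set"] by (simp add: lessThan_atLeast0)
  then show ?thesis unfolding idx_def by (rule someI_ex)
qed

lemma idx_less: "idx (r :: 'k::finite) < CARD('k)"
  using bij_idx[where 'k = 'k] by (auto simp: bij_betw_def)

lemma idx_eq_iff: "idx r = idx s \<longleftrightarrow> r = s"
  using bij_idx by (auto simp: bij_betw_def inj_on_def)

lemma idx_ex: assumes "m < CARD('k)" shows "\<exists>r :: 'k::finite. idx r = m"
  using bij_idx[where 'k = 'k] assms unfolding bij_betw_def by (metis image_iff lessThan_iff)

definition rowmat :: "(complex^'k) list \<Rightarrow> complex^'k^'k" where
  "rowmat ws = (\<chi> r. ws ! idx r)"

text \<open>With the value 0 on lists of the wrong length, skew-symmetry and linearity hold without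
  a length hypothesis.\<close>

definition ldet :: "(complex^'k) list \<Rightarrow> complex" where
  "ldet ws = (if length ws = CARD('k) then det (rowmat ws) else 0)"

lemma ldet_not_distinct:
  fixes ws :: "(complex^'k) list"
  assumes "\<not> distinct ws"
  shows "ldet ws = 0"
proof (cases "length ws = CARD('k)")
  case True
  obtain i j where ij: "i < length ws" "j < length ws" "i \<noteq> j" "ws ! i = ws ! j"
    using assms by (auto simp: distinct_conv_nth)
  obtain r :: 'k where r: "idx r = i" using idx_ex[where 'k = 'k, of i] ij True by auto
  obtain s :: 'k where s: "idx s = j" using idx_ex[where 'k = 'k, of j] ij True by auto
  note rs = r s
  have "row r (rowmat ws) = row s (rowmat ws)" "r \<noteq> s"
    using rs ij by (auto simp: row_def rowmat_def)
  then show ?thesis using det_identical_rows by (auto simp: ldet_def)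
qed (simp add: ldet_def)

lemma ldet_adjacent:
  fixes xs :: "(complex^'k) list"
  shows "ldet (xs @ b # a # ys) = - ldet (xs @ a # b # ys)"
proof (cases "length (xs @ a # b # ys) = CARD('k)")
  case True
  let ?m = "length xs" and ?ws = "xs @ a # b # ys"
  obtain r :: 'k where r: "idx r = ?m" using idx_ex[where 'k = 'k, of ?m] True by auto
  obtain s :: 'k where s: "idx s = Suc ?m" using idx_ex[where 'k = 'k, of "Suc ?m"] True by auto
  have "r \<noteq> s" using r s by auto
  let ?p = "Transposition.transpose r s"
  have "(xs @ b # a # ys) ! idx q = ?ws ! idx (?p q)" for q :: 'k
  proof (cases "q = r \<or> q = s")
    case True then show ?thesis using r s by (auto simp: nth_append)
  next
    case False
    then have "idx q \<noteq> ?m" "idx q \<noteq> Suc ?m" using r s idx_eq_iff by metis+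
    then have "(xs @ b # a # ys) ! idx q = ?ws ! idx q"
      by (cases "idx q < ?m") (auto simp: nth_append nth_Cons split: nat.splits)
    then show ?thesis using False by simp
  qed
  then have "rowmat (xs @ b # a # ys) = (\<chi> q. rowmat ?ws $ ?p q)"
    unfolding rowmat_def by simp
  then have "det (rowmat (xs @ b # a # ys)) = of_int (sign ?p) * det (rowmat ?ws)"
    using det_permute_rows[of ?p "rowmat ?ws"] by (simp add: permutes_swap_id)
  then show ?thesis using True \<open>r \<noteq> s\<close> by (simp add: ldet_def sign_swap_id)
qed (simp add: ldet_def)

lemma ldet_linear:
  fixes w :: "'b \<Rightarrow> complex^'k"
  assumes "finite S"
  shows "ldet (ps @ (\<Sum>j\<in>S. c j *s w j) # qs) = (\<Sum>j\<in>S. c j * ldet (ps @ w j # qs))"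
proof (cases "length ps + Suc (length qs) = CARD('k)")
  case True
  obtain r :: 'k where r: "idx r = length ps" using idx_ex[where 'k = 'k, of "length ps"] True by auto
  \<comment> \<open>The other rows come from a list with the dummy entry 0, so they do not depend on
    \<open>z\<close>: this is the shape in which linearity of \<open>det\<close> in one row is
    stated.\<close>
  have R: "rowmat (ps @ z # qs) = (\<chi> q. if q = r then z else (ps @ 0 # qs) ! idx q)" for z
    unfolding rowmat_def vec_eq_iff
  proof (intro allI)
    fix q j
    show "(\<chi> q. (ps @ z # qs) ! idx q) $ q $ j = (\<chi> q. if q = r then z else (ps @ 0 # qs) ! idx q) $ q $ j"
    proof (cases "q = r")
      case False
      then have "idx q \<noteq> length ps" using r idx_eq_iff by metis
      then show ?thesis using False by (auto simp: nth_append nth_Cons split: nat.splits)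
    qed (simp add: r)
  qed
  show ?thesis
    using True det_linear_row_sum[OF assms, where k = r and a = "\<lambda>_ j. c j *s w j" and c = "\<lambda>q. (ps @ 0 # qs) ! idx q"]
      by (simp add: ldet_def R det_row_mul)
qed (simp add: ldet_def)

lemma bij_betw_rows:
  assumes "length us = CARD('k)" "distinct us"
  shows "bij_betw (\<lambda>r::'k::finite. us ! idx r) UNIV (set us)"
  using bij_betw_trans[OF bij_idx[where 'k = 'k] bij_betw_nth[OF assms(2), of "{..<CARD('k)}" "set us"]] assms
  by (simp add: o_def)

lemma ldet_nonzero_iff:
  fixes g :: "nat \<Rightarrow> complex^'k"
  assumes len: "length us = CARD('k)" and dist: "distinct us"
  shows "ldet (map g us) \<noteq> 0 \<longleftrightarrow> indep g (set us)"
proof -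
  have row: "row r (rowmat (map g us)) = g (us ! idx r)" for r :: 'k
    unfolding rowmat_def row_def using len idx_less[of r] by (simp add: vec_lambda_eta)
  have "ldet (map g us) \<noteq> 0 \<longleftrightarrow> invertible (rowmat (map g us))"
    using len by (simp add: ldet_def invertible_det_nz)
  also have "\<dots> \<longleftrightarrow> (\<exists>B. rowmat (map g us) ** B = mat 1)"
    by (simp add: invertible_right_inverse)
  also have "\<dots> \<longleftrightarrow> (\<forall>c. (\<Sum>r\<in>(UNIV::'k set). c r *s g (us ! idx r)) = 0 \<longrightarrow> (\<forall>r. c r = 0))"
    by (simp add: matrix_right_invertible_independent_rows row)
  also have "\<dots> \<longleftrightarrow> indep g (set us)"
    unfolding indep_def
  proof (intro iffI allI impI ballI)
    fix c u
    assume H: "\<forall>c. (\<Sum>r\<in>(UNIV::'k set). c r *s g (us ! idx r)) = 0 \<longrightarrow> (\<forall>r. c r = 0)"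
      and 0: "(\<Sum>u\<in>set us. c u *s g u) = 0" and u: "u \<in> set us"
    obtain m where "m < CARD('k)" "us ! m = u" using u len by (metis in_set_conv_nth)
    then obtain r :: 'k where "us ! idx r = u" using idx_ex by metis
    moreover have "\<forall>r::'k. c (us ! idx r) = 0"
      using H[THEN spec, of "\<lambda>r. c (us ! idx r)"] 0 sum.reindex_bij_betw[OF bij_betw_rows[OF len dist], of "\<lambda>u. c u *s g u"]
      by simp
    ultimately show "c u = 0" by blast
  next
    fix c :: "'k \<Rightarrow> complex" and r :: 'k
    assume H: "\<forall>c. (\<Sum>i\<in>set us. c i *s g i) = 0 \<longrightarrow> (\<forall>i\<in>set us. c i = 0)"
      and 0: "(\<Sum>r\<in>(UNIV::'k set). c r *s g (us ! idx r)) = 0"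
    \<comment> \<open>\<open>h\<close> carries coefficients from row indices to the entries of
      \<open>us\<close>; it is well defined because the entries are distinct.\<close>
    define h where "h u = c (THE r. us ! idx r = u)" for u
    have h: "h (us ! idx r) = c r" for r
    proof -
      have "(THE s. us ! idx s = us ! idx r) = r"
        using dist len idx_less[where 'k = 'k] by (intro the_equality) (simp_all add: nth_eq_iff_index_eq idx_eq_iff)
      then show ?thesis by (simp add: h_def)
    qed
    have "(\<Sum>u\<in>set us. h u *s g u) = 0" using 0 sum.reindex_bij_betw[OF bij_betw_rows[OF len dist], of "\<lambda>u. h u *s g u"] h by simp
    then have "h (us ! idx r) = 0" using H[THEN spec, of h] len idx_less[of r] by simp
    then show "c r = 0" using h by simp
  qed
  finally show ?thesis .
qed

section \<open>Linear systems and bases of forms\<close>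

lemma dual_solution:
  fixes g :: "nat \<Rightarrow> complex^'k"
  assumes "finite U" "card U = CARD('k)" "indep g U"
  obtains t :: "complex^'k" where "\<forall>u\<in>U. (\<Sum>i\<in>UNIV. t $ i * g u $ i) = b u"
proof -
  obtain us where us: "set us = U" "distinct us" using finite_distinct_list[OF assms(1)] by blast
  have len: "length us = CARD('k)" using us assms distinct_card by metis
  let ?A = "rowmat (map g us)"
  have "invertible ?A"
    using ldet_nonzero_iff[OF len us(2), of g] us assms len by (simp add: ldet_def invertible_det_nz)
  then obtain B where B: "?A ** B = mat 1" unfolding invertible_def by blast
  define t where "t = B *v (\<chi> r. b (us ! idx r))"
  have At: "?A *v t = (\<chi> r. b (us ! idx r))"
    unfolding t_def by (simp add: matrix_vector_mul_assoc B)
  have "(\<Sum>i\<in>UNIV. t $ i * g u $ i) = b u" if u: "u \<in> U" for u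
  proof -
    obtain m where "m < CARD('k)" "us ! m = u" using u us len by (metis in_set_conv_nth)
    then obtain r :: 'k where r: "us ! idx r = u" using idx_ex by metis
    have "(?A *v t) $ r = (\<Sum>i\<in>UNIV. g u $ i * t $ i)"
      using len idx_less[of r] r by (simp add: matrix_vector_mult_def rowmat_def)
    then show ?thesis using At r by (simp add: mult.commute)
  qed
  then show ?thesis by (intro that) blast
qed

lemma basis_expansion:
  fixes g :: "nat \<Rightarrow> complex^'k"
  assumes "finite U" "card U = CARD('k)" "indep g U"
  obtains d where "w = (\<Sum>u\<in>U. d u *s g u)"
proof -
  obtain us where us: "set us = U" "distinct us" using finite_distinct_list[OF assms(1)] by blast
  have len: "length us = CARD('k)" using us assms distinct_card by metis
  let ?A = "rowmat (map g us)"
  have "invertible ?A"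
    using ldet_nonzero_iff[OF len us(2), of g] us assms len by (simp add: ldet_def invertible_det_nz)
  then obtain B where B: "B ** ?A = mat 1" unfolding invertible_def by blast
  let ?c = "w v* B" and ?e = "\<lambda>r::'k. us ! idx r"
  have e: "inj ?e" using bij_betw_rows[OF len us(2)] by (simp add: bij_betw_def)
  have "w = ?c v* ?A" by (simp add: vector_matrix_mul_assoc B)
  also have "\<dots> = (\<Sum>r\<in>UNIV. ?c $ r *s g (?e r))"
    using len idx_less[where 'k = 'k]
    by (simp add: vec_eq_iff vector_matrix_mult_def rowmat_def mult.commute)
  also have "\<dots> = (\<Sum>r\<in>UNIV. ?c $ (inv ?e (?e r)) *s g (?e r))"
    by (simp add: inv_f_f[OF e])
  also have "\<dots> = (\<Sum>u\<in>U. ?c $ (inv ?e u) *s g u)"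
    using sum.reindex_bij_betw[OF bij_betw_rows[OF len us(2)], of "\<lambda>u. ?c $ (inv ?e u) *s g u"] us by simp
  finally show ?thesis by (rule that)
qed

text \<open>A basis is chosen among the vectors \<open>g j\<close> and lifted to a set of indices on
  which \<open>g\<close> is injective, since different indices may carry the same form.\<close>

lemma ex_indepK:
  fixes g :: "nat \<Rightarrow> complex^'k"
  assumes "\<forall>w::complex^'k. \<exists>c. w = (\<Sum>j<n. c j *s g j)"
  obtains U where "U \<in> indepK n g"
proof -
  let ?V = "g ` {..<n}"
  obtain B where B: "B \<subseteq> ?V" "vec.independent B" "?V \<subseteq> vec.span B" "card B = vec.dim ?V"
    using vec.basis_exists[of ?V] by blast
  have "vec.span ?V = UNIV"
  proof -
    have "w \<in> vec.span ?V" for w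
    proof -
      obtain c where "w = (\<Sum>j<n. c j *s g j)" using assms by blast
      also have "\<dots> \<in> vec.span ?V"
        by (intro vec.span_sum vec.span_scale vec.span_base) auto
      finally show ?thesis .
    qed
    then show ?thesis by blast
  qed
  then have "vec.dim ?V = CARD('k)" by (metis vec.dim_span vec_dim_card)
  obtain U where U: "U \<subseteq> {..<n}" "inj_on g U" "B = g ` U"
    using B(1) by (meson subset_image_inj)
  have fin: "finite U" using U(1) finite_subset by blast
  have "card U = CARD('k)" using U B \<open>vec.dim ?V = _\<close> card_image by metis
  moreover have "indep g U"
    unfolding indep_def
  proof (intro allI impI ballI)
    fix c i assume c: "(\<Sum>i\<in>U. c i *s g i) = 0" and i: "i \<in> U"
    have "(\<Sum>b\<in>B. c (the_inv_into U g b) *s b) = 0"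
      unfolding U(3) sum.reindex[OF U(2)] using c
      by (simp add: the_inv_into_f_f[OF U(2)] cong: sum.cong)
    then have "c (the_inv_into U g (g i)) = 0"
      using B(2) fin U(3) i vec.dependent_finite[of B] by auto
    then show "c i = 0" using the_inv_into_f_f[OF U(2) i] by simp
  qed
  ultimately show ?thesis using that U(1) unfolding indepK_def by blast
qed

subsection \<open>The operators of circuits\<close>

lemma finite_indepK: "finite (indepK n g)"
  by (rule finite_subset[of _ "Pow {..<n}"]) (auto simp: indepK_def)

lemma indepKD:
  fixes g :: "nat \<Rightarrow> complex^'k"
  assumes "U \<in> indepK n g"
  shows "finite U" "U \<subseteq> {..<n}" "card U = CARD('k)" "indep g U"
  using assms by (auto simp: indepK_def intro: finite_subset)

lemma circuitD:
  assumes "circuit n g C"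
  shows "finite C" "C \<subseteq> {..<n}" "\<not> indep g C" "D \<subset> C \<Longrightarrow> indep g D"
  using assms by (auto simp: circuit_def intro: finite_subset)

lemma finite_circuits: "finite {C. circuit n g C}"
  by (rule finite_subset[of _ "Pow {..<n}"]) (auto simp: circuit_def)

lemma indep_mono:
  assumes "indep g T" "S \<subseteq> T" "finite T"
  shows "indep g S"
  unfolding indep_def
proof (intro allI impI)
  fix c assume c: "(\<Sum>i\<in>S. c i *s g i) = 0"
  have "(\<Sum>i\<in>T. (if i \<in> S then c i else 0) *s g i) = (\<Sum>i\<in>S. c i *s g i)"
    using assms by (intro sum.mono_neutral_cong_right) auto
  then have "\<forall>i\<in>T. (if i \<in> S then c i else 0) = 0"
    using assms(1)[unfolded indep_def, THEN spec, of "\<lambda>i. if i \<in> S then c i else 0"] c by simp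
  then show "\<forall>i\<in>S. c i = 0" using assms(2) by (metis subsetD)
qed

text \<open>Such a tuple is dependent. In exchange sums over a basis this removes every entry
  outside the fundamental circuit: replacing it leaves a tuple that contains the whole
  circuit.\<close>

lemma coef_superset_circuit:
  assumes "circuit n g C" "C \<subseteq> set us"
  shows "coef n g v us = 0"
  using assms circuitD(3)[OF assms(1)] indep_mono[of g "set us" C] by (auto simp: coef_def indepK_def)

lemma coef_not_distinct: "\<not> distinct us \<Longrightarrow> coef n g v us = 0"
  by (simp add: coef_def)

lemma coef_indepK:
  fixes g :: "nat \<Rightarrow> complex^'k"
  assumes "distinct us" "set us \<in> indepK n g"
  shows "coef n g v us = lsign us * v (set us)"
  using assms distinct_card[OF assms(1)] indepKD(3)[OF assms(2)] by (simp add: coef_def)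

lemma coef_nonzero_indepK: "coef n g v us \<noteq> 0 \<Longrightarrow> set us \<in> indepK n g"
  by (auto simp: coef_def split: if_splits)

lemma ldel_append: "ldel (length p) (p @ x # q) = p @ q"
  by (simp add: ldel_def)

lemma ldel_distinct:
  assumes "distinct xs" "m < length xs"
  shows "distinct (ldel m xs)" "set (ldel m xs) = set xs - {xs ! m}"
proof -
  obtain p q where xs: "xs = p @ xs ! m # q" "length p = m"
    using id_take_nth_drop[OF assms(2)] assms(2) by (metis length_take min.absorb4)
  have l: "ldel m xs = p @ q" using xs ldel_append[of p "xs ! m" q] by simp
  have "distinct (p @ xs ! m # q)" using assms(1) xs(1) by simp
  moreover have "set xs = set (p @ xs ! m # q)" using xs(1) by simp
  ultimately show "distinct (ldel m xs)" "set (ldel m xs) = set xs - {xs ! m}"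
    unfolding l by auto
qed

lemma split_two:
  assumes "l < m" "m < length xs"
  obtains p q r where "xs = p @ xs ! l # q @ xs ! m # r" "length p = l" "length p + Suc (length q) = m"
proof -
  let ?t = "take m xs"
  have "xs = ?t @ xs ! m # drop (Suc m) xs" using assms id_take_nth_drop by blast
  moreover have "?t = take l ?t @ ?t ! l # drop (Suc l) ?t"
    using assms by (intro id_take_nth_drop) simp
  ultimately have "xs = take l ?t @ xs ! l # drop (Suc l) ?t @ xs ! m # drop (Suc m) xs"
    using assms by (metis append.assoc append_Cons nth_take)
  then show ?thesis using assms by (intro that) auto
qed

text \<open>This turns omissions into exchanges. The two lists differ by moving one entry past those
  strictly between positions \<open>l\<close> and \<open>m\<close>; their number has parity opposite
  to \<open>m + l\<close>, whence the minus sign.\<close>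

lemma alternating_ldel:
  assumes alt: "alternating A" and dist: "distinct (cl @ sl)"
    and l: "l < length cl" and m: "m < length cl" and "l \<noteq> m"
  shows "A (map (id(cl ! m := cl ! l)) (ldel l cl @ sl)) = - ((-1) ^ (m + l) * A (ldel m cl @ sl))"
proof (cases "l < m")
  case True
  obtain p q r where s: "cl = p @ cl ! l # q @ cl ! m # r" "length p = l" "length p + Suc (length q) = m"
    using split_two[OF True m] by blast
  define i u where "i = cl ! l" and "u = cl ! m"
  have cl: "cl = p @ i # q @ u # r" using s i_def u_def by simp
  have notin: "u \<notin> set p" "u \<notin> set q" "u \<notin> set r" "u \<notin> set sl" using dist unfolding cl by auto
  have "ldel l cl = p @ q @ u # r" using ldel_append[of p i "q @ u # r"] cl s by simp
  then have 1: "map (id(u := i)) (ldel l cl @ sl) = p @ q @ i # r @ sl"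
    using notin by (simp add: map_upd_notin)
  have "ldel m cl = (p @ i # q) @ r" using ldel_append[of "p @ i # q" u r] cl s by simp
  then have "A (ldel m cl @ sl) = (-1) ^ length q * A (p @ q @ i # r @ sl)"
    using alternating_move[OF alt, of p i q "r @ sl"] by simp
  moreover have "(-1::complex) ^ (m + l) = - ((-1) ^ length q)"
    using s(2) s(3)[symmetric] by (simp add: power_add)
  ultimately show ?thesis using 1 unfolding i_def u_def by (simp flip: power_add)
next
  case False
  then have "m < l" using \<open>l \<noteq> m\<close> by simp
  then obtain p q r where s: "cl = p @ cl ! m # q @ cl ! l # r" "length p = m" "length p + Suc (length q) = l"
    using split_two[OF _ l] by blast
  define i u where "i = cl ! l" and "u = cl ! m"
  have cl: "cl = p @ u # q @ i # r" using s i_def u_def by simp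
  have notin: "u \<notin> set p" "u \<notin> set q" "u \<notin> set r" "u \<notin> set sl" using dist unfolding cl by auto
  have "ldel l cl = (p @ u # q) @ r" using ldel_append[of "p @ u # q" i r] cl s by simp
  then have 1: "map (id(u := i)) (ldel l cl @ sl) = p @ i # q @ r @ sl"
    using notin by (simp add: map_upd_notin)
  have "ldel m cl = p @ q @ i # r" using ldel_append[of p u "q @ i # r"] cl s by simp
  then have "A (p @ i # q @ r @ sl) = (-1) ^ length q * A (ldel m cl @ sl)"
    using alternating_move[OF alt, of p i q "r @ sl"] by simp
  moreover have "(-1::complex) ^ (m + l) = - ((-1) ^ length q)"
    using s(2) s(3)[symmetric] by (simp add: power_add)
  ultimately show ?thesis using 1 unfolding i_def u_def by simp
qed

section \<open>Matrix entries of a circuit operator\<close>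

lemma Fvec_outside: "U \<notin> indepK n g \<Longrightarrow> Fvec n g ts U = 0"
  by (auto simp: Fvec_def)

lemma LC_outside: "U \<notin> indepK n g \<Longrightarrow> LC n g a C v U = 0"
  by (auto simp: LC_def LC_basis_def Let_def Fvec_outside intro!: sum.neutral)

lemma Fvec_indepK:
  fixes g :: "nat \<Rightarrow> complex^'k"
  assumes "U \<in> indepK n g" "distinct ts"
  shows "Fvec n g ts U = (if set ts = U then lsign ts else 0)"
  using assms distinct_card[OF assms(2)] indepKD(3)[OF assms(1)] by (auto simp: Fvec_def)

text \<open>The entry can be nonzero only if \<open>S\<close> and \<open>U\<close> agree outside
  \<open>C\<close> and each misses exactly one member of \<open>C\<close>. The position missed by
  \<open>S\<close> is written as a sum over \<open>m\<close> with an indicator, so that a later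
  summation over \<open>S\<close> collapses.\<close>

lemma LC_basis_indepK:
  fixes g :: "nat \<Rightarrow> complex^'k"
  assumes U: "U \<in> indepK n g" and S: "S \<in> indepK n g" and C: "finite C"
    and cl_def: "cl = sorted_list_of_set C" and sl_def: "sl = sorted_list_of_set (U - C)"
  shows "LC_basis n g a C S U =
    (\<Sum>m<length cl. if S = (C - {cl ! m}) \<union> (U - C)
       then (-1) ^ m * lsign (ldel m cl @ sl) *
         (\<Sum>l<length cl. if U \<inter> C = C - {cl ! l} then (-1) ^ l * a (cl ! l) * lsign (ldel l cl @ sl) else 0)
       else 0)"
proof -
  have cl: "distinct cl" "set cl = C" using C by (auto simp: cl_def)
  have sl: "distinct sl" "set sl = U - C" using indepKD(1)[OF U] by (auto simp: sl_def)
  have clC: "cl ! m \<in> C" if "m < length cl" for m using that cl nth_mem by blast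
  have Siff: "S = (C - {cl ! m}) \<union> (U - C) \<longleftrightarrow> S \<inter> C = C - {cl ! m} \<and> S - C = U - C" for m
    by blast
  have uniq: "m = m0" if "S \<inter> C = C - {cl ! m}" "S \<inter> C = C - {cl ! m0}" "m < length cl" "m0 < length cl" for m m0
  proof -
    have "cl ! m = cl ! m0" using that clC by blast
    then show ?thesis using that cl nth_eq_iff_index_eq by blast
  qed
  show ?thesis
  proof (cases "\<exists>m<length cl. S \<inter> C = C - {cl ! m}")
    case False
    then have "LC_basis n g a C S U = 0" by (auto simp: LC_basis_def Let_def cl_def)
    then show ?thesis using False Siff by (auto intro!: sum.neutral)
  next
    case True
    then obtain m0 where m0: "m0 < length cl" "S \<inter> C = C - {cl ! m0}" by blast
    have the: "(THE m. m < length cl \<and> S \<inter> C = C - {cl ! m}) = m0"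
      using m0 uniq by (intro the_equality) blast+
    let ?s = "sorted_list_of_set (S - C)"
    have LB: "LC_basis n g a C S U = lsign (ldel m0 cl @ ?s) * (-1) ^ (m0 + 1) *
              (\<Sum>l<length cl. (-1) ^ (l + 1) * a (cl ! l) * Fvec n g (ldel l cl @ ?s) U)"
      using True the unfolding LC_basis_def Let_def cl_def[symmetric] by simp
    have F: "Fvec n g (ldel l cl @ ?s) U =
        (if S - C = U - C \<and> U \<inter> C = C - {cl ! l} then lsign (ldel l cl @ sl) else 0)"
      if l: "l < length cl" for l
    proof -
      have d: "distinct (ldel l cl @ ?s)"
        using ldel_distinct[OF cl(1) l] cl indepKD(1)[OF S] by auto
      have "set (ldel l cl @ ?s) = (C - {cl ! l}) \<union> (S - C)"
        using ldel_distinct[OF cl(1) l] cl indepKD(1)[OF S] by simp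
      moreover have "(C - {cl ! l}) \<union> (S - C) = U \<longleftrightarrow> S - C = U - C \<and> U \<inter> C = C - {cl ! l}"
        by blast
      ultimately show ?thesis unfolding Fvec_indepK[OF U d] by (auto simp: sl_def)
    qed
    show ?thesis
    proof (cases "S - C = U - C")
      case False
      then show ?thesis unfolding LB Siff by (simp add: F)
    next
      case eq: True
      have "(S = (C - {cl ! m}) \<union> (U - C)) = (m = m0)" if "m < length cl" for m
        unfolding Siff using eq m0 uniq that by blast
      then have "(\<Sum>m<length cl. if S = (C - {cl ! m}) \<union> (U - C) then E m else 0) =
          (\<Sum>m<length cl. if m = m0 then E m else 0)" for E :: "nat \<Rightarrow> complex"
        by (intro sum.cong) auto
      also have "(\<Sum>m<length cl. if m = m0 then E m else 0) = E m0" for E :: "nat \<Rightarrow> complex"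
        using m0 by simp
      finally have R: "(\<Sum>m<length cl. if S = (C - {cl ! m}) \<union> (U - C) then E m else 0) = E m0"
        for E :: "nat \<Rightarrow> complex" .
      \<comment> \<open>The shift in \<open>l + 1\<close> pulls out a minus sign, which cancels the
        one from \<open>m0 + 1\<close>.\<close>
      have "(\<Sum>l<length cl. (-1) ^ (l + 1) * a (cl ! l) * Fvec n g (ldel l cl @ ?s) U) =
        - (\<Sum>l<length cl. if U \<inter> C = C - {cl ! l} then (-1) ^ l * a (cl ! l) * lsign (ldel l cl @ sl) else 0)"
        unfolding sum_negf[symmetric] by (intro sum.cong refl) (simp add: F[unfolded eq] eq)
      then show ?thesis unfolding LB R by (simp add: eq sl_def)
    qed
  qed
qed

text \<open>For a fixed part \<open>U - C\<close> outside the circuit the operator has rank one: an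
  alternating sum of coefficients of \<open>v\<close>, times a factor that depends only on the
  member of \<open>C\<close> missed by \<open>U\<close>.\<close>

lemma LC_indepK:
  fixes g :: "nat \<Rightarrow> complex^'k"
  assumes U: "U \<in> indepK n g" and C: "circuit n g C"
    and cl_def: "cl = sorted_list_of_set C" and sl_def: "sl = sorted_list_of_set (U - C)"
  shows "LC n g a C v U = (\<Sum>m<length cl. (-1) ^ m * coef n g v (ldel m cl @ sl)) *
    (\<Sum>l<length cl. if U \<inter> C = C - {cl ! l} then (-1) ^ l * a (cl ! l) * lsign (ldel l cl @ sl) else 0)"
proof -
  have fin: "finite C" using circuitD(1)[OF C] .
  have cl: "distinct cl" "set cl = C" using fin by (auto simp: cl_def)
  have sl: "distinct sl" "set sl = U - C" using indepKD(1)[OF U] by (auto simp: sl_def)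
  define Q where "Q = (\<Sum>l<length cl. if U \<inter> C = C - {cl ! l} then (-1) ^ l * a (cl ! l) * lsign (ldel l cl @ sl) else 0)"
  have "LC n g a C v U = (\<Sum>S\<in>indepK n g. \<Sum>m<length cl. if S = (C - {cl ! m}) \<union> (U - C)
      then v S * ((-1) ^ m * lsign (ldel m cl @ sl) * Q) else 0)"
    unfolding LC_def Q_def
    by (intro sum.cong refl)
       (simp add: LC_basis_indepK[OF U _ fin cl_def sl_def] sum_distrib_left if_distrib cong: if_cong)
  also have "\<dots> = (\<Sum>m<length cl. \<Sum>S\<in>indepK n g. if S = (C - {cl ! m}) \<union> (U - C)
      then v S * ((-1) ^ m * lsign (ldel m cl @ sl) * Q) else 0)"
    by (rule sum.swap)
  also have "\<dots> = (\<Sum>m<length cl. (-1) ^ m * coef n g v (ldel m cl @ sl) * Q)"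
  proof (intro sum.cong refl)
    fix m assume "m \<in> {..<length cl}"
    then have m: "m < length cl" by simp
    have d: "distinct (ldel m cl @ sl)" and s: "set (ldel m cl @ sl) = (C - {cl ! m}) \<union> (U - C)"
      using ldel_distinct[OF cl(1) m] cl sl by auto
    show "(\<Sum>S\<in>indepK n g. if S = (C - {cl ! m}) \<union> (U - C)
      then v S * ((-1) ^ m * lsign (ldel m cl @ sl) * Q) else 0) = (-1) ^ m * coef n g v (ldel m cl @ sl) * Q"
    proof (cases "set (ldel m cl @ sl) \<in> indepK n g")
      case True
      then show ?thesis unfolding coef_indepK[OF d True] s
        using finite_indepK[of n g] by (simp add: mult_ac)
    next
      case False
      then have "coef n g v (ldel m cl @ sl) = 0" using coef_nonzero_indepK by blast
      moreover have "S \<noteq> (C - {cl ! m}) \<union> (U - C)" if "S \<in> indepK n g" for S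
        using False that unfolding s by blast
      ultimately show ?thesis by simp
    qed
  qed
  finally show ?thesis unfolding Q_def sum_distrib_right .
qed

text \<open>Here \<open>U\<close> misses at least two members of \<open>C\<close>, so the second
  factor of the rank-one formula is empty.\<close>

lemma LC_eq_0:
  assumes U: "U \<in> indepK n g" and C: "circuit n g C" and j: "j \<in> C" "j \<notin> U" "C - U \<noteq> {j}"
  shows "LC n g a C v U = 0"
proof -
  have "U \<inter> C \<noteq> C - {sorted_list_of_set C ! l}" for l using j by blast
  then show ?thesis unfolding LC_indepK[OF U C refl refl] by simp
qed

text \<open>The left side is the skew-symmetric coefficient of \<open>LC n g a C v\<close> at
  \<open>us\<close>. For a listing that starts with the members of \<open>C\<close>, the rank-one
  formula gives an alternating sum over omissions, which \<open>alternating_ldel\<close> rewrites as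
  exchanges.\<close>

lemma LC_exch:
  fixes g :: "nat \<Rightarrow> complex^'k"
  assumes U: "U \<in> indepK n g" and C: "circuit n g C" and i: "C - U = {i}"
    and us: "distinct us" "set us = U"
  shows "lsign us * LC n g a C v U = a i * exch (coef n g v) us i"
proof -
  define cl sl where "cl = sorted_list_of_set C" and "sl = sorted_list_of_set (U - C)"
  have fin: "finite C" using circuitD(1)[OF C] .
  have cl: "distinct cl" "set cl = C" using fin by (auto simp: cl_def)
  have sl: "distinct sl" "set sl = U - C" using indepKD(1)[OF U] by (auto simp: sl_def)
  have "i \<in> C" using i by blast
  then obtain l where l: "l < length cl" "cl ! l = i" using cl by (metis in_set_conv_nth)
  let ?A = "coef n g v"
  define vs where "vs = ldel l cl @ sl"
  have vs: "distinct vs" "set vs = U" unfolding vs_def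
    using ldel_distinct[OF cl(1) l(1)] cl sl i l by auto
  have eq: "(U \<inter> C = C - {cl ! k}) = (k = l)" if "k < length cl" for k
  proof -
    have "(U \<inter> C = C - {cl ! k}) = (cl ! k = cl ! l)" using i l that cl nth_mem[of k cl] by auto
    then show ?thesis using cl(1) l(1) that nth_eq_iff_index_eq by blast
  qed
  have "(\<Sum>k<length cl. if U \<inter> C = C - {cl ! k} then (-1) ^ k * a (cl ! k) * lsign (ldel k cl @ sl) else 0)
     = (\<Sum>k<length cl. if k = l then (-1) ^ k * a (cl ! k) * lsign (ldel k cl @ sl) else 0)"
    by (intro sum.cong) (auto simp: eq)
  also have "\<dots> = (-1) ^ l * a i * lsign vs" using l by (simp add: vs_def)
  finally have L: "LC n g a C v U = a i * lsign vs * (\<Sum>m<length cl. (-1) ^ (m + l) * ?A (ldel m cl @ sl))"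
    unfolding LC_indepK[OF U C cl_def sl_def] by (simp add: sum_distrib_right sum_distrib_left power_add mult_ac)
  \<comment> \<open>Only \<open>u\<close> in the circuit contributes: for the others the new tuple
    contains all of \<open>C\<close>.\<close>
  have "(\<Sum>u\<in>U. ?A (map (id(u := i)) vs)) = (\<Sum>u\<in>C - {i}. ?A (map (id(u := i)) vs))"
  proof (intro sum.mono_neutral_right ballI)
    show "finite U" using indepKD(1)[OF U] .
    show "C - {i} \<subseteq> U" using i by blast
    fix u assume "u \<in> U - (C - {i})"
    then have "u \<in> U" "u \<notin> C" using i by auto
    then have "C \<subseteq> set (map (id(u := i)) vs)" using vs i by auto
    then show "?A (map (id(u := i)) vs) = 0" by (rule coef_superset_circuit[OF C])
  qed
  also have "\<dots> = (\<Sum>m\<in>{..<length cl} - {l}. ?A (map (id(cl ! m := i)) vs))"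
  proof -
    have "bij_betw ((!) cl) ({..<length cl} - {l}) (C - {i})"
      using bij_betw_nth[OF cl(1) refl cl(2)[symmetric]] l
      by (intro bij_betw_DiffI) (auto simp: bij_betw_def)
    from sum.reindex_bij_betw[OF this, of "\<lambda>u. ?A (map (id(u := i)) vs)"] show ?thesis by simp
  qed
  also have "\<dots> = (\<Sum>m\<in>{..<length cl} - {l}. - ((-1) ^ (m + l) * ?A (ldel m cl @ sl)))"
  proof (intro sum.cong refl)
    fix m assume "m \<in> {..<length cl} - {l}"
    then have m: "m < length cl" "l \<noteq> m" by auto
    have "distinct (cl @ sl)" using cl sl by auto
    from alternating_ldel[OF alternating_coef this l(1) m, of n g v]
    show "?A (map (id(cl ! m := i)) vs) = - ((-1) ^ (m + l) * ?A (ldel m cl @ sl))"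
      unfolding vs_def l(2) .
  qed
  finally have "exch ?A vs i = ?A vs + (\<Sum>m\<in>{..<length cl} - {l}. (-1) ^ (m + l) * ?A (ldel m cl @ sl))"
    unfolding exch_def vs(2) by (simp add: sum_negf)
  also have "\<dots> = (\<Sum>m<length cl. (-1) ^ (m + l) * ?A (ldel m cl @ sl))"
    using l by (subst sum.remove[of _ l]) (auto simp: vs_def simp flip: power_mult_distrib mult_2 power_add)
  finally have E: "LC n g a C v U = a i * (lsign vs * exch ?A vs i)" unfolding L by simp
  \<comment> \<open>Passage from the adapted listing \<open>vs\<close> to the given listing
    \<open>us\<close>.\<close>
  have "lsign vs * exch ?A vs i = lsign us * exch ?A us i"
    by (rule lsign_alternating_eq) (use alternating_exch[OF alternating_coef] vs us in auto)
  then show ?thesis unfolding E using lsign_square[of us] by (simp add: mult_ac)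
qed

subsection \<open>The operators of the Gauss--Manin equations\<close>

locale arrangement =
  fixes n :: nat and g :: "nat \<Rightarrow> complex^'k" and lam :: "nat set \<Rightarrow> nat \<Rightarrow> complex"
  assumes lam_circuit: "circuit n g C \<Longrightarrow>
    (\<forall>i. i \<notin> C \<longrightarrow> lam C i = 0) \<and> (\<exists>i. lam C i \<noteq> 0) \<and> (\<Sum>i\<in>C. lam C i *s g i) = 0"
begin

lemma lam_outside: "circuit n g C \<Longrightarrow> i \<notin> C \<Longrightarrow> lam C i = 0"
  using lam_circuit by blast

lemma lam_relation:
  assumes "circuit n g C" "C \<subseteq> S" "finite S"
  shows "(\<Sum>i\<in>S. lam C i *s g i) = 0"
proof -
  have "(\<Sum>i\<in>S. lam C i *s g i) = (\<Sum>i\<in>C. lam C i *s g i)"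
    using assms lam_outside by (intro sum.mono_neutral_right) auto
  then show ?thesis using lam_circuit[OF assms(1)] by simp
qed

text \<open>Otherwise the relation would live on the independent set \<open>C - {i}\<close> and be
  trivial.\<close>

lemma lam_nonzero:
  assumes C: "circuit n g C" and i: "i \<in> C"
  shows "lam C i \<noteq> 0"
proof
  assume 0: "lam C i = 0"
  have fin: "finite C" using circuitD(1)[OF C] .
  have "(\<Sum>j\<in>C - {i}. lam C j *s g j) = 0"
    using lam_relation[OF C subset_refl fin] sum.remove[OF fin i, of "\<lambda>j. lam C j *s g j"] 0 by simp
  moreover have "indep g (C - {i})" using circuitD(4)[OF C] i by blast
  ultimately have "\<forall>j\<in>C - {i}. lam C j = 0" unfolding indep_def by blast
  then have "lam C j = 0" for j using 0 lam_outside[OF C, of j] by blast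
  then show False using lam_circuit[OF C] by blast
qed

section \<open>Fundamental circuits: \<open>C - U = {i}\<close> says that \<open>C\<close> is that
  of \<open>i\<close> over \<open>U\<close>\<close>

lemma fundamental_relation:
  assumes "circuit n g C" "C - U = {i}" "finite U"
  shows "lam C i *s g i = (\<Sum>u\<in>U. (- lam C u) *s g u)"
proof -
  have "i \<notin> U" and "C \<subseteq> insert i U" using assms by auto
  then have "lam C i *s g i + (\<Sum>u\<in>U. lam C u *s g u) = 0"
    using lam_relation[OF assms(1), of "insert i U"] assms(3) by simp
  then show ?thesis by (simp add: sum_negf add_eq_0_iff2)
qed

lemma fundamental_sum:
  fixes h :: "nat \<Rightarrow> complex"
  assumes "circuit n g C" "C - U = {i}" "U \<subseteq> {..<n}"
  shows "(\<Sum>j<n. lam C j * h j) = lam C i * h i + (\<Sum>u\<in>U. lam C u * h u)"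
proof -
  have "finite U" "i \<notin> U" using assms by (auto intro: finite_subset)
  moreover have "(\<Sum>j<n. lam C j * h j) = (\<Sum>j\<in>insert i U. lam C j * h j)"
    using assms circuitD(2)[OF assms(1)] lam_outside[OF assms(1)]
    by (intro sum.mono_neutral_right) auto
  ultimately show ?thesis by simp
qed

text \<open>Eliminating \<open>g i\<close> from the two relations leaves one on the independent set
  \<open>U\<close>, so the relations are proportional and have the same support. The support of a
  relation is its circuit by \<open>lam_nonzero\<close>.\<close>

lemma fundamental_circuit_unique:
  assumes U: "indep g U" "finite U"
    and C: "circuit n g C" "C - U = {i}" and C': "circuit n g C'" "C' - U = {i}"
  shows "C = C'"
proof -
  have "(\<Sum>u\<in>U. (lam C i * lam C' u - lam C' i * lam C u) *s g u)
      = lam C' i *s (\<Sum>u\<in>U. (- lam C u) *s g u) - lam C i *s (\<Sum>u\<in>U. (- lam C' u) *s g u)"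
    by (simp add: vec_eq_iff sum_negf sum_subtractf sum_distrib_left algebra_simps)
  also have "\<dots> = lam C' i *s (lam C i *s g i) - lam C i *s (lam C' i *s g i)"
    using fundamental_relation[OF C U(2)] fundamental_relation[OF C' U(2)] by simp
  also have "\<dots> = 0" by (simp add: vec_eq_iff)
  finally have e: "lam C i * lam C' u = lam C' i * lam C u" if "u \<in> U" for u
    using U(1)[unfolded indep_def, THEN spec, of "\<lambda>u. lam C i * lam C' u - lam C' i * lam C u"] that
    by simp
  have i: "lam C i \<noteq> 0" "lam C' i \<noteq> 0" "i \<in> C" "i \<in> C'"
    using lam_nonzero[OF C(1)] lam_nonzero[OF C'(1)] C C' by auto
  have "u \<in> C \<longleftrightarrow> u \<in> C'" if "u \<in> U" for u
    using e[OF that] i lam_nonzero[OF C(1), of u] lam_nonzero[OF C'(1), of u]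
      lam_outside[OF C(1), of u] lam_outside[OF C'(1), of u] by (cases "u \<in> C"; cases "u \<in> C'") auto
  then show ?thesis using C(2) C'(2) by blast
qed

lemma fundamental_circuit_exists:
  assumes U: "U \<in> indepK n g" and i: "i < n" "i \<notin> U"
  obtains C where "circuit n g C" "C - U = {i}"
proof -
  note D = indepKD[OF U]
  obtain d where d: "g i = (\<Sum>u\<in>U. d u *s g u)" using basis_expansion[OF D(1,3,4)] .
  have "(\<Sum>u\<in>insert i U. (if u = i then - 1 else d u) *s g u) = - g i + (\<Sum>u\<in>U. (if u = i then - 1 else d u) *s g u)"
    using D(1) i by (simp add: vector_scalar_commute)
  also have "(\<Sum>u\<in>U. (if u = i then - 1 else d u) *s g u) = (\<Sum>u\<in>U. d u *s g u)"
    using i by (intro sum.cong) auto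
  finally have z: "(\<Sum>u\<in>insert i U. (if u = i then - 1 else d u) *s g u) = 0" using d by simp
  have dep: "\<not> indep g (insert i U)"
  proof
    assume "indep g (insert i U)"
    from this[unfolded indep_def, THEN spec, of "\<lambda>u. if u = i then - 1 else d u"] z
    show False by simp
  qed
  let ?F = "{C. C \<subseteq> insert i U \<and> \<not> indep g C}"
  have "finite ?F" using D(1) by simp
  \<comment> \<open>A minimal dependent subset is a circuit; it must contain \<open>i\<close>
    because \<open>U\<close> is independent.\<close>
  then obtain C where C: "C \<in> ?F" "\<forall>B\<in>?F. B \<subseteq> C \<longrightarrow> C = B"
    using finite_has_minimal2[of ?F "insert i U"] dep by auto
  have "C \<subseteq> {..<n}" using C(1) D(2) i by auto
  then have circ: "circuit n g C" unfolding circuit_def using C by blast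
  have "\<not> C \<subseteq> U" using C(1) indep_mono[OF D(4) _ D(1), of C] by blast
  then have "C - U = {i}" using C(1) by auto
  then show ?thesis using circ that by blast
qed

section \<open>Coefficients of the operators at a basis\<close>

lemma Kop_outside: "U \<notin> indepK n g \<Longrightarrow> Kop n g lam a j x v U = 0"
  by (simp add: Kop_def LC_outside)

text \<open>Circuits avoiding \<open>j\<close> have coefficient 0 at \<open>j\<close>, and any other
  circuit through \<open>j\<close> misses a further element outside \<open>U\<close>, where
  \<open>LC_eq_0\<close> applies. One term of the sum survives.\<close>

lemma Kop_fundamental:
  assumes U: "U \<in> indepK n g" and C: "circuit n g C" "C - U = {j}"
  shows "Kop n g lam a j x v U = lam C j / fC lam n C x * LC n g a C v U"
proof -
  note D = indepKD[OF U]
  have "lam C' j / fC lam n C' x * LC n g a C' v U = 0" if C': "circuit n g C'" "C' \<noteq> C" for C'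
  proof (cases "j \<in> C'")
    case True
    have "C' - U \<noteq> {j}" using fundamental_circuit_unique[OF D(4,1) C C'(1)] C'(2) by blast
    then show ?thesis using LC_eq_0[OF U C'(1) True] C(2) by auto
  next
    case False then show ?thesis using lam_outside[OF C'(1)] by simp
  qed
  then have "(\<Sum>C'\<in>{C. circuit n g C} - {C}. lam C' j / fC lam n C' x * LC n g a C' v U) = 0"
    by (intro sum.neutral) auto
  then show ?thesis
    unfolding Kop_def using C(1) by (simp add: sum.remove[OF finite_circuits, of C])
qed

text \<open>Each circuit contributes a multiple of its own relation. This puts eigenvalues into the
  annihilator of \<open>Y\<close>, and it links the operators with index in a basis to the remaining
  ones.\<close>

lemma Kop_relation: "(\<Sum>j<n. Kop n g lam a j x v U *s g j) = 0"
proof -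
  have "(\<Sum>j<n. Kop n g lam a j x v U *s g j) =
     (\<Sum>C\<in>{C. circuit n g C}. \<Sum>j<n. (LC n g a C v U / fC lam n C x) *s (lam C j *s g j))"
    unfolding Kop_def
    by (subst sum.swap) (simp add: vec_eq_iff sum_distrib_left mult_ac)
  also have "\<dots> = (\<Sum>C\<in>{C. circuit n g C}. (LC n g a C v U / fC lam n C x) *s (\<Sum>j<n. lam C j *s g j))"
    by (simp add: vec.scale_sum_right)
  also have "\<dots> = 0"
    by (intro sum.neutral ballI) (simp add: lam_relation circuitD(2))
  finally show ?thesis .
qed

lemma Kop_exch:
  assumes U: "U \<in> indepK n g" and C: "circuit n g C" "C - U = {j}"
    and us: "distinct us" "set us = U"
  shows "lsign us * Kop n g lam a j x v U = lam C j / fC lam n C x * (a j * exch (coef n g v) us j)"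
  using LC_exch[OF U C us, of a v] unfolding Kop_fundamental[OF U C] by (simp add: mult_ac)

lemma exchange_indepK:
  assumes U: "U \<in> indepK n g" and C: "circuit n g C" "C - U = {i}" and u: "u \<in> U" "u \<in> C"
  shows "insert i (U - {u}) \<in> indepK n g"
proof -
  note D = indepKD[OF U]
  have i: "i \<notin> U" "i < n" "i \<in> C" using C circuitD(2)[OF C(1)] by auto
  have "indep g (insert i (U - {u}))"
    unfolding indep_def
  proof (intro allI impI)
    fix c assume c: "(\<Sum>j\<in>insert i (U - {u}). c j *s g j) = 0"
    \<comment> \<open>Coefficients of \<open>lam C i\<close> times the given relation after
      \<open>g i\<close> has been eliminated through the relation of \<open>C\<close>.\<close>
    define e where "e w = (if w = u then 0 else lam C i * c w) - c i * lam C w" for w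
    have "(\<Sum>w\<in>U. e w *s g w) = lam C i *s (\<Sum>w\<in>U - {u}. c w *s g w) + c i *s (\<Sum>w\<in>U. (- lam C w) *s g w)"
      unfolding e_def sum.remove[OF D(1) u(1)]
      by (simp add: vec_eq_iff sum_negf sum_subtractf sum_distrib_left algebra_simps)
    also have "\<dots> = lam C i *s (\<Sum>j\<in>insert i (U - {u}). c j *s g j)"
      unfolding fundamental_relation[OF C D(1), symmetric]
      using i D(1) by (simp add: vec_eq_iff algebra_simps)
    finally have "\<forall>w\<in>U. e w = 0" using c D(4)[unfolded indep_def, THEN spec, of e] by simp
    then have z: "e w = 0" if "w \<in> U" for w using that by blast
    have "c i = 0" using z[OF u(1)] lam_nonzero[OF C(1) u(2)] by (simp add: e_def)
    moreover have "c w = 0" if "w \<in> U - {u}" for w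
      using z[of w] that \<open>c i = 0\<close> lam_nonzero[OF C(1) i(3)] by (auto simp: e_def)
    ultimately show "\<forall>j\<in>insert i (U - {u}). c j = 0" by blast
  qed
  moreover have "card (insert i (U - {u})) = CARD('k)"
    using D(1,3) i u by (metis card_insert_disjoint card_Suc_Diff1 Diff_iff finite_Diff)
  ultimately show ?thesis using D(2) i unfolding indepK_def by blast
qed

end

lemma map_upd_props:
  assumes "distinct us" "u \<in> set us" "i \<notin> set us"
  shows "distinct (map (id(u := i)) us)" "set (map (id(u := i)) us) = insert i (set us - {u})"
  using assms by (auto simp: distinct_map inj_on_def)

text \<open>\<open>SingV\<close> states the equation for \<open>j\<close> in first place followed by
  an increasing list. The sum is alternating in \<open>us\<close>, with \<open>j\<close> standing in
  for \<open>u\<close>, so it vanishes for every listing.\<close>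

lemma SingV_coef:
  fixes g :: "nat \<Rightarrow> complex^'k"
  assumes v: "v \<in> SingV n g a" and U: "U \<in> indepK n g" and u: "u \<in> U"
    and us: "distinct us" "set us = U"
  shows "(\<Sum>j<n. a j * coef n g v (map (id(u := j)) us)) = 0"
proof -
  note D = indepKD[OF U]
  define A where "A us = (\<Sum>j<n. a j * coef n g v (map (id(u := j)) us))" for us
  have alt: "alternating A"
    unfolding alternating_def
  proof (intro allI)
    fix xs ys :: "nat list" and b c :: nat
    have "coef n g v (map f (xs @ c # b # ys)) = - coef n g v (map f (xs @ b # c # ys))" for f
      using alternating_coef[of n g v] unfolding alternating_def map_append list.map by blast
    then show "A (xs @ c # b # ys) = - A (xs @ b # c # ys)"
      unfolding A_def by (simp only: mult_minus_right sum_negf)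
  qed
  let ?T = "U - {u}"
  let ?ts = "sorted_list_of_set ?T"
  have "card ?T = CARD('k) - 1" "indep g ?T" "?T \<subseteq> {..<n}"
    using D u indep_mono[OF D(4), of ?T] by auto
  then have "(\<Sum>j<n. a j * coef n g v (j # ?ts)) = 0" using v unfolding SingV_def by blast
  moreover have "map (id(u := j)) (u # ?ts) = j # ?ts" for j
    using D(1) by (simp add: map_upd_notin)
  ultimately have "A (u # ?ts) = 0" unfolding A_def by simp
  then have "lsign us * A us = 0"
    using lsign_alternating_eq[OF alt, of us "u # ?ts"] us D(1) u by auto
  then show ?thesis by (simp add: A_def lsign_def)
qed

subsection \<open>Eigenvalues of joint eigenvectors\<close>

context arrangement
begin

context
  fixes a x y :: "nat \<Rightarrow> complex" and v :: "nat set \<Rightarrow> complex"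
  assumes nz: "\<And>C. circuit n g C \<Longrightarrow> fC lam n C x \<noteq> 0"
    and eig: "\<And>j U. j < n \<Longrightarrow> Kop n g lam a j x v U = y j * v U"
begin

lemma eigen_exch:
  assumes U: "U \<in> indepK n g" and C: "circuit n g C" "C - U = {i}"
    and us: "distinct us" "set us = U"
  shows "lam C i * a i * exch (coef n g v) us i = fC lam n C x * y i * coef n g v us"
proof -
  have "i < n" using C circuitD(2)[OF C(1)] by auto
  then have "lam C i / fC lam n C x * (a i * exch (coef n g v) us i) = y i * coef n g v us"
    using Kop_exch[OF U C us, of a x v] eig coef_indepK[OF us(1), of n g v] U us(2)
    by (simp add: mult_ac)
  then show ?thesis using nz[OF C(1)] by (simp add: field_simps)
qed

text \<open>For \<open>u\<close> in \<open>C\<close> this is \<open>eigen_exch\<close> at the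
  exchanged basis, over which \<open>C\<close> is the fundamental circuit of \<open>u\<close>,
  combined with \<open>exch_swap\<close>. For \<open>u\<close> outside \<open>C\<close> both sides
  vanish.\<close>

lemma eigen_exch_swap:
  assumes U: "U \<in> indepK n g" and C: "circuit n g C" "C - U = {i}"
    and us: "distinct us" "set us = U" and u: "u \<in> U"
  shows "lam C u * a u * exch (coef n g v) us i
    = - (fC lam n C x * y u * coef n g v (map (id(u := i)) us))"
proof (cases "u \<in> C")
  case True
  have i: "i \<notin> U" "i \<in> C" using C by auto
  let ?us = "map (id(u := i)) us"
  note P = map_upd_props[OF us(1), of u i, unfolded us(2), OF u i(1)]
  have "C - insert i (U - {u}) = {u}" using C True u i by blast
  have "exch (coef n g v) ?us u = - exch (coef n g v) us i"
    using exch_swap[OF alternating_coef us(1)] us(2) u i by blast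
  from eigen_exch[OF exchange_indepK[OF U C u True] C(1) \<open>C - _ = {u}\<close> P, unfolded this]
  show ?thesis by (metis minus_minus mult_minus_right)
next
  case False
  have i: "i \<notin> U" using C by auto
  have "C \<subseteq> set (map (id(u := i)) us)"
    using map_upd_props(2)[OF us(1), of u i] us(2) u i C False by auto
  then show ?thesis using coef_superset_circuit[OF C(1)] lam_outside[OF C(1) False] by simp
qed

lemma eigen_relation:
  assumes "v \<noteq> (\<lambda>S. 0)"
  shows "(\<Sum>j<n. y j *s g j) = 0"
proof -
  obtain U where U: "v U \<noteq> 0" using assms by auto
  have "v U *s (\<Sum>j<n. y j *s g j) = (\<Sum>j<n. Kop n g lam a j x v U *s g j)"
    using eig by (simp add: vec.scale_sum_right mult.commute)
  also have "\<dots> = 0" by (rule Kop_relation)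
  finally show ?thesis using U by simp
qed

lemma eigen_point:
  assumes y: "\<And>j. j < n \<Longrightarrow> y j \<noteq> 0" and U: "U \<in> indepK n g" "v U \<noteq> 0"
  obtains t :: "complex^'k" where "\<forall>j<n. x j = (\<Sum>i\<in>UNIV. t $ i * g j $ i) + a j / y j"
proof -
  note D = indepKD[OF U(1)]
  obtain us where us: "distinct us" "set us = U" using finite_distinct_list[OF D(1)] by blast
  let ?c = "coef n g v"
  have c: "?c us \<noteq> 0"
    using coef_indepK[OF us(1), of n g v] us(2) U by (simp add: lsign_def)
  \<comment> \<open>The point is determined by the coordinates in \<open>U\<close>; the remaining
    ones are then forced by the fundamental circuits.\<close>
  obtain t :: "complex^'k" where t: "\<forall>u\<in>U. (\<Sum>i\<in>UNIV. t $ i * g u $ i) = x u - a u / y u"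
    by (rule dual_solution[OF D(1,3,4), of "\<lambda>u. x u - a u / y u"])
  let ?q = "\<lambda>j. \<Sum>i\<in>UNIV. t $ i * g j $ i"
  have "x i = ?q i + a i / y i" if i: "i < n" "i \<notin> U" for i
  proof -
    obtain C where C: "circuit n g C" "C - U = {i}" by (rule fundamental_circuit_exists[OF U(1) i])
    let ?R = "exch ?c us i" and ?f = "fC lam n C x"
    have f: "?f \<noteq> 0" using nz C by blast
    have R1: "lam C i * (a i / y i) * ?R = ?f * ?c us"
      using eigen_exch[OF U(1) C us] y[OF i(1)] by (simp add: field_simps)
    have R2: "lam C u * (a u / y u) * ?R = - (?f * ?c (map (id(u := i)) us))" if "u \<in> U" for u
    proof -
      have "y u \<noteq> 0" using y that D(2) by blast
      then show ?thesis using eigen_exch_swap[OF U(1) C us that] by (simp add: field_simps)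
    qed
    have R: "?R \<noteq> 0" using R1 f c by auto
    have "(\<Sum>j<n. lam C j * (a j / y j)) * ?R
        = lam C i * (a i / y i) * ?R + (\<Sum>u\<in>U. lam C u * (a u / y u) * ?R)"
      unfolding fundamental_sum[OF C D(2)] by (simp add: algebra_simps sum_distrib_left)
    also have "(\<Sum>u\<in>U. lam C u * (a u / y u) * ?R) = - (?f * (\<Sum>u\<in>U. ?c (map (id(u := i)) us)))"
      unfolding sum_distrib_left sum_negf[symmetric] by (intro sum.cong refl R2)
    also have "lam C i * (a i / y i) * ?R + - (?f * (\<Sum>u\<in>U. ?c (map (id(u := i)) us))) = ?f * ?R"
      unfolding R1 by (simp add: exch_def us(2) right_diff_distrib)
    finally have "(\<Sum>j<n. lam C j * (a j / y j)) = ?f" using R by simp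
    moreover have "(\<Sum>j<n. lam C j * ?q j) = 0"
    proof -
      \<comment> \<open>The linear function of a circuit vanishes on \<open>Y\<close>.\<close>
      have "(\<Sum>j<n. lam C j * ?q j) = (\<Sum>i\<in>UNIV. t $ i * (\<Sum>j<n. lam C j *s g j) $ i)"
        by (simp add: sum_distrib_left mult_ac) (rule sum.swap)
      then show ?thesis using lam_relation[OF C(1) circuitD(2)[OF C(1)]] by simp
    qed
    ultimately have "(\<Sum>j<n. lam C j * (x j - ?q j - a j / y j)) = 0"
      unfolding fC_def right_diff_distrib sum_subtractf by simp
    then have "lam C i * (x i - ?q i - a i / y i) = 0"
      unfolding fundamental_sum[OF C D(2)] using t by simp
    moreover have "lam C i \<noteq> 0" using lam_nonzero C by blast
    ultimately have "x i - ?q i - a i / y i = 0" by simp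
    then show ?thesis by (simp add: diff_diff_eq)
  qed
  then have "\<forall>j<n. x j = ?q j + a j / y j" using t by (metis add.commute diff_add_cancel)
  then show ?thesis by (rule that)
qed

text \<open>If \<open>Z\<close>, the zero set of \<open>y\<close>, were nonempty, then \<open>c(U) = \<Sum>\<^sub>u c(U[u := i])\<close> over
  \<open>u \<in> U \<inter> Z\<close> for every \<open>i \<in> Z\<close>; weighting by \<open>a i\<close> and summing over \<open>i\<close> turns the
  right-hand side into singular-vector sums, so \<open>(\<Sum>\<^sub>Z a) c(U) = 0\<close>.\<close>

lemma eigen_nonzero:
  assumes a: "\<And>j. j < n \<Longrightarrow> a j \<noteq> 0"
    and gen: "\<And>Z. Z \<subseteq> {..<n} \<Longrightarrow> Z \<noteq> {} \<Longrightarrow> (\<Sum>j\<in>Z. a j) \<noteq> 0"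
    and v: "v \<in> SingV n g a" and U: "U \<in> indepK n g" "v U \<noteq> 0" and j: "j < n"
  shows "y j \<noteq> 0"
proof
  assume yj: "y j = 0"
  define Z where "Z = {j. j < n \<and> y j = 0}"
  have Z: "Z \<subseteq> {..<n}" "Z \<noteq> {}" "finite Z" using j yj by (auto simp: Z_def)
  note D = indepKD[OF U(1)]
  obtain us where us: "distinct us" "set us = U" using finite_distinct_list[OF D(1)] by blast
  let ?c = "coef n g v"
  let ?s = "\<lambda>u i. ?c (map (id(u := i)) us)"
  have c: "?c us \<noteq> 0"
    using coef_indepK[OF us(1), of n g v] us(2) U by (simp add: lsign_def)
  have dup: "?s u i = 0" if "i \<in> U" "u \<in> U" "u \<noteq> i" for u i
  proof -
    have "\<not> inj_on (id(u := i)) (set us)" using that us(2) by (auto simp: inj_on_def intro!: bexI[of _ u] bexI[of _ i])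
    then have "\<not> distinct (map (id(u := i)) us)" by (simp add: distinct_map)
    then show ?thesis by (rule coef_not_distinct)
  qed
  have in_Z: "(\<Sum>u\<in>U \<inter> Z. ?s u i) = ?c us" if i: "i \<in> Z" for i
  proof (cases "i \<in> U")
    case True
    have "(\<Sum>u\<in>U \<inter> Z. ?s u i) = (\<Sum>u\<in>{i}. ?s u i)"
      using D(1) True i dup by (intro sum.mono_neutral_right) auto
    then show ?thesis by (simp add: fun_upd_idem)
  next
    case False
    have "i < n" "y i = 0" using i by (auto simp: Z_def)
    obtain C where C: "circuit n g C" "C - U = {i}" using fundamental_circuit_exists[OF U(1) \<open>i < n\<close> False] .
    have "lam C i \<noteq> 0" using lam_nonzero C by blast
    then have R: "exch ?c us i = 0"
      using eigen_exch[OF U(1) C us] a[OF \<open>i < n\<close>] \<open>y i = 0\<close> by simp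
    have "?s u i = 0" if "u \<in> U - Z" for u
    proof -
      have "y u \<noteq> 0" using that D(2) by (auto simp: Z_def)
      then show ?thesis using eigen_exch_swap[OF U(1) C us, of u] that R nz[OF C(1)] by simp
    qed
    then have "(\<Sum>u\<in>U. ?s u i) = (\<Sum>u\<in>U \<inter> Z. ?s u i)"
      using D(1) by (intro sum.mono_neutral_right) auto
    then show ?thesis using R by (simp add: exch_def us(2))
  qed
  \<comment> \<open>For \<open>u\<close> in \<open>Z\<close>, replacement by an index outside
    \<open>Z\<close> contributes nothing. This allows the sum over \<open>Z\<close> to be extended
    to all indices, as the equations of singular vectors require.\<close>
  have not_Z: "?s u i = 0" if i: "i < n" "i \<notin> Z" and u: "u \<in> U \<inter> Z" for u i
  proof (cases "i \<in> U")
    case True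
    then show ?thesis using dup u i by blast
  next
    case False
    have "y i \<noteq> 0" "y u = 0" "u < n" using i u by (auto simp: Z_def)
    obtain C where C: "circuit n g C" "C - U = {i}" using fundamental_circuit_exists[OF U(1) i(1) False] .
    have "exch ?c us i \<noteq> 0"
      using eigen_exch[OF U(1) C us] nz[OF C(1)] c \<open>y i \<noteq> 0\<close> by auto
    then have "lam C u = 0"
      using eigen_exch_swap[OF U(1) C us, of u] u \<open>y u = 0\<close> a[OF \<open>u < n\<close>] by auto
    then have "u \<notin> C" using lam_nonzero[OF C(1)] by blast
    then have "C \<subseteq> set (map (id(u := i)) us)"
      using map_upd_props(2)[OF us(1), of u i] us(2) u False C by auto
    then show ?thesis by (rule coef_superset_circuit[OF C(1)])
  qed
  have "(\<Sum>i\<in>Z. a i) * ?c us = (\<Sum>i\<in>Z. a i * (\<Sum>u\<in>U \<inter> Z. ?s u i))"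
    using in_Z by (simp add: sum_distrib_right)
  also have "\<dots> = (\<Sum>u\<in>U \<inter> Z. \<Sum>i\<in>Z. a i * ?s u i)"
    unfolding sum_distrib_left by (rule sum.swap)
  also have "\<dots> = (\<Sum>u\<in>U \<inter> Z. \<Sum>i<n. a i * ?s u i)"
    using Z not_Z by (intro sum.cong refl sum.mono_neutral_left) auto
  also have "\<dots> = 0"
    using SingV_coef[OF v U(1) _ us] by (intro sum.neutral) auto
  finally show False using gen[OF Z(1,2)] c by simp
qed

end

end

subsection \<open>Eigenvectors of critical points\<close>

lemma prod_replace:
  fixes f :: "nat \<Rightarrow> complex"
  assumes "finite U" "u \<in> U" "i \<notin> U" "f u \<noteq> 0"
  shows "prod f (insert i (U - {u})) = f i * prod f U / f u"
  using assms by (simp add: prod.remove[of U u])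

context arrangement
begin

text \<open>Cramer's rule: the relation of \<open>C\<close> is substituted for \<open>g i\<close> in
  the slot of \<open>u\<close>, and every term with \<open>w\<close> other than \<open>u\<close> has
  a repeated row.\<close>

lemma ldet_exchange:
  assumes U: "finite U" and C: "circuit n g C" "C - U = {i}"
    and us: "distinct us" "set us = U" and u: "u \<in> U"
  shows "lam C i * ldet (map g (map (id(u := i)) us)) = - lam C u * ldet (map g us)"
proof -
  obtain p q where pq: "us = p @ u # q" using u us(2) by (meson split_list)
  have notin: "u \<notin> set p" "u \<notin> set q" using us(1) pq by auto
  have "map g (map (id(u := i)) us) = map g p @ g i # map g q"
    unfolding pq using notin by (simp add: map_upd_notin del: map_map)
  then have "lam C i * ldet (map g (map (id(u := i)) us)) = ldet (map g p @ (lam C i *s g i) # map g q)"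
    using ldet_linear[of "{i}" "map g p" "lam C" g "map g q"] by simp
  also have "\<dots> = (\<Sum>w\<in>U. - lam C w * ldet (map g p @ g w # map g q))"
    unfolding fundamental_relation[OF C U] by (rule ldet_linear[OF U])
  also have "\<dots> = (\<Sum>w\<in>{u}. - lam C w * ldet (map g p @ g w # map g q))"
  proof (intro sum.mono_neutral_right ballI)
    fix w assume "w \<in> U - {u}"
    then have "w \<in> set p \<union> set q" using us(2) pq by auto
    then have "\<not> distinct (map g p @ g w # map g q)" by auto
    from ldet_not_distinct[OF this] show "- lam C w * ldet (map g p @ g w # map g q) = 0" by simp
  qed (use U u in auto)
  finally show ?thesis by (simp add: pq)
qed

text \<open>The eigenvector of a critical point of \<open>\<Prod>\<^sub>j f\<^sub>j\<^bsup>a j\<^esup>\<close>, where \<open>f j\<close> is the value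
  there of the affine form \<open>g\<^sub>j + x j\<close>.\<close>

definition crit_vec :: "(nat \<Rightarrow> complex) \<Rightarrow> nat set \<Rightarrow> complex" where
  "crit_vec f U = (if U \<in> indepK n g
     then lsign (sorted_list_of_set U) * ldet (map g (sorted_list_of_set U)) / prod f U else 0)"

text \<open>The determinant is alternating and the product symmetric, so the formula passes from the
  increasing listing to any other. On repeated or dependent tuples both sides are 0.\<close>

lemma coef_crit_vec:
  assumes "length us = CARD('k)" "set us \<subseteq> {..<n}"
  shows "coef n g (crit_vec f) us = ldet (map g us) / prod f (set us)"
proof (cases "distinct us \<and> set us \<in> indepK n g")
  case True
  let ?vs = "sorted_list_of_set (set us)"
  have alt: "alternating (\<lambda>us. ldet (map g us))"
    unfolding alternating_def map_append list.map using ldet_adjacent by blast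
  have "lsign us * ldet (map g us) = lsign ?vs * ldet (map g ?vs)"
    using lsign_alternating_eq[OF alt, of us ?vs] True by simp
  then have "coef n g (crit_vec f) us = lsign us * (lsign us * ldet (map g us)) / prod f (set us)"
    using True by (simp add: coef_indepK crit_vec_def)
  also have "lsign us * (lsign us * ldet (map g us)) = ldet (map g us)"
    using lsign_square[of us] by (simp flip: mult.assoc)
  finally show ?thesis .
next
  case False
  then have "coef n g (crit_vec f) us = 0" by (auto simp: coef_def)
  moreover have "ldet (map g us) = 0"
  proof (cases "distinct us")
    case True
    then have "\<not> indep g (set us)"
      using False assms distinct_card[OF True] by (auto simp: indepK_def)
    then show ?thesis using ldet_nonzero_iff[OF assms(1) True] by blast
  next
    case False
    then show ?thesis using ldet_not_distinct[of "map g us"] by (auto simp: distinct_map)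
  qed
  ultimately show ?thesis by simp
qed

context
  fixes a p q x f :: "nat \<Rightarrow> complex" and t :: "complex^'k"
  assumes p: "\<And>j. j < n \<Longrightarrow> p j \<noteq> 0" and a: "\<And>j. j < n \<Longrightarrow> a j \<noteq> 0"
    and crit: "(\<Sum>j<n. p j *s g j) = 0"
    and f: "\<And>j. j < n \<Longrightarrow> f j = a j / p j"
    and q: "\<And>j. j < n \<Longrightarrow> q j = (\<Sum>i\<in>UNIV. t $ i * g j $ i)"
    and x: "\<And>j. j < n \<Longrightarrow> x j = q j + f j"
begin

text \<open>Since \<open>a j / f j = p j\<close>, the sum becomes, up to the product of
  \<open>f\<close> over \<open>T\<close>, a determinant with first row the sum of the
  \<open>p j *s g j\<close>. That row is 0 by the critical point equation
  \<open>crit\<close>.\<close>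

lemma crit_vec_Sing: "crit_vec f \<in> SingV n g a"
proof -
  have "(\<Sum>j<n. a j * coef n g (crit_vec f) (j # sorted_list_of_set T)) = 0"
    if T: "T \<subseteq> {..<n}" "card T = CARD('k) - 1" for T
  proof -
    let ?ts = "sorted_list_of_set T"
    have fin: "finite T" using T(1) finite_subset by blast
    have "a j * coef n g (crit_vec f) (j # ?ts) = p j * ldet ([] @ g j # map g ?ts) / prod f T"
      if j: "j < n" for j
    proof (cases "j \<in> T")
      case True
      then have "g j \<in> set (map g ?ts)" using fin by simp
      then have "\<not> distinct ([] @ g j # map g ?ts)" by simp
      from ldet_not_distinct[OF this] True fin show ?thesis by (simp add: coef_not_distinct)
    next
      case False
      have "length (j # ?ts) = CARD('k)" "set (j # ?ts) \<subseteq> {..<n}" using T j fin by auto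
      then show ?thesis
        using False fin f[OF j] p[OF j] a[OF j] unfolding coef_crit_vec[OF \<open>length _ = _\<close> \<open>set _ \<subseteq> _\<close>] by simp
    qed
    then have "(\<Sum>j<n. a j * coef n g (crit_vec f) (j # ?ts))
        = (\<Sum>j<n. p j * ldet ([] @ g j # map g ?ts)) / prod f T"
      by (simp add: sum_divide_distrib)
    also have "(\<Sum>j<n. p j * ldet ([] @ g j # map g ?ts)) = ldet ([] @ 0 # map g ?ts)"
      using ldet_linear[of "{..<n}" "[]" p g "map g ?ts"] crit by simp
    also have "\<dots> = 0" using ldet_linear[of "{}" "[]" p g "map g ?ts"] by simp
    finally show ?thesis by simp
  qed
  moreover have "crit_vec f \<in> Vsp n g" by (simp add: Vsp_def crit_vec_def)
  ultimately show ?thesis by (simp add: SingV_def)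
qed

text \<open>By Cramer's rule each exchanged coefficient is a multiple of the original one, and these
  multiples add up to the value of the circuit function at \<open>f\<close>. This equals its value
  at \<open>x\<close>, because \<open>x\<close> and \<open>f\<close> differ by the point
  \<open>q\<close> of \<open>Y\<close>.\<close>

lemma crit_vec_exch:
  assumes U: "U \<in> indepK n g" and C: "circuit n g C" "C - U = {i}"
    and us: "distinct us" "set us = U"
  shows "lam C i * a i * exch (coef n g (crit_vec f)) us i
    = fC lam n C x * p i * coef n g (crit_vec f) us"
proof -
  note D = indepKD[OF U]
  let ?c = "coef n g (crit_vec f)"
  have i: "i < n" "i \<notin> U" using C circuitD(2)[OF C(1)] by auto
  have fnz: "f j \<noteq> 0" if "j < n" for j using f a p that by simp
  have len: "length us = CARD('k)" using us D(3) distinct_card by metis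
  have c: "?c us = ldet (map g us) / prod f U" using coef_crit_vec[OF len] us(2) D(2) by simp
  have e: "lam C i * f i * ?c (map (id(u := i)) us) = - (lam C u * f u) * ?c us" if u: "u \<in> U" for u
  proof -
    have s: "set (map (id(u := i)) us) = insert i (U - {u})"
      using map_upd_props(2)[OF us(1), of u i] us(2) u i by simp
    have "?c (map (id(u := i)) us) = ldet (map g (map (id(u := i)) us)) / prod f (insert i (U - {u}))"
      unfolding s[symmetric] using len D(2) i s by (intro coef_crit_vec) auto
    moreover have "f u \<noteq> 0" using fnz u D(2) by blast
    ultimately have "lam C i * f i * ?c (map (id(u := i)) us)
        = (lam C i * ldet (map g (map (id(u := i)) us))) * f u / prod f U"
      using prod_replace[OF D(1) u i(2)] fnz[OF i(1)] by simp
    then show ?thesis unfolding ldet_exchange[OF D(1) C us u] c by simp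
  qed
  have "lam C i * f i * exch ?c us i = lam C i * f i * ?c us + (\<Sum>u\<in>U. lam C u * f u * ?c us)"
    unfolding exch_def us(2) right_diff_distrib sum_distrib_left by (simp add: e sum_negf)
  also have "\<dots> = (\<Sum>j<n. lam C j * f j) * ?c us"
    unfolding fundamental_sum[OF C D(2)] by (simp add: distrib_right sum_distrib_right)
  also have "(\<Sum>j<n. lam C j * f j) = fC lam n C x"
  proof -
    have "(\<Sum>j<n. lam C j * q j) = (\<Sum>i\<in>UNIV. t $ i * (\<Sum>j<n. lam C j *s g j) $ i)"
      using q by (simp add: sum_distrib_left mult_ac) (rule sum.swap)
    then have "(\<Sum>j<n. lam C j * q j) = 0" using lam_relation[OF C(1) circuitD(2)[OF C(1)]] by simp
    then show ?thesis unfolding fC_def using x by (simp add: distrib_left sum.distrib)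
  qed
  finally have "lam C i * f i * exch ?c us i * p i = fC lam n C x * ?c us * p i" by simp
  moreover have "f i * p i = a i" using f[OF i(1)] p[OF i(1)] by simp
  ultimately show ?thesis by (metis mult.assoc mult.commute)
qed

text \<open>Outside \<open>U\<close> the fundamental circuit gives the claim. The defects
  \<open>d j\<close> satisfy the relation of the operators and that of \<open>p\<close>; being
  supported on the independent set \<open>U\<close>, they vanish.\<close>

lemma crit_vec_eigen:
  assumes nz: "\<And>C. circuit n g C \<Longrightarrow> fC lam n C x \<noteq> 0" and j: "j < n"
  shows "Kop n g lam a j x (crit_vec f) U = p j * crit_vec f U"
proof (cases "U \<in> indepK n g")
  case False
  then show ?thesis by (simp add: Kop_outside crit_vec_def)
next
  case U: True
  note D = indepKD[OF U]
  let ?v = "crit_vec f"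
  obtain us where us: "distinct us" "set us = U" using finite_distinct_list[OF D(1)] by blast
  have out: "Kop n g lam a j x ?v U = p j * ?v U" if j: "j < n" "j \<notin> U" for j
  proof -
    obtain C where C: "circuit n g C" "C - U = {j}" by (rule fundamental_circuit_exists[OF U j])
    have "lsign us * Kop n g lam a j x ?v U
        = (lam C j * a j * exch (coef n g ?v) us j) / fC lam n C x"
      using Kop_exch[OF U C us, of a x ?v] by simp
    also have "\<dots> = p j * coef n g ?v us"
      unfolding crit_vec_exch[OF U C us] using nz[OF C(1)] by simp
    also have "\<dots> = lsign us * (p j * ?v U)"
      using coef_indepK[OF us(1), of n g ?v] U us(2) by simp
    finally show ?thesis by (simp add: lsign_def)
  qed
  define d where "d j = Kop n g lam a j x ?v U - p j * ?v U" for j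
  have "(\<Sum>j\<in>U. d j *s g j) = (\<Sum>j<n. d j *s g j)"
    using out D(2) by (intro sum.mono_neutral_left) (auto simp: d_def)
  also have "\<dots> = (\<Sum>j<n. Kop n g lam a j x ?v U *s g j) - ?v U *s (\<Sum>j<n. p j *s g j)"
    by (simp add: d_def vec_eq_iff sum_subtractf sum_distrib_left algebra_simps)
  also have "\<dots> = 0" by (simp add: Kop_relation crit)
  finally have "\<forall>j\<in>U. d j = 0" using D(4)[unfolded indep_def, THEN spec, of d] by simp
  then show ?thesis using out[OF j] by (cases "j \<in> U") (auto simp: d_def)
qed

lemma crit_vec_nonzero:
  assumes "U \<in> indepK n g"
  shows "crit_vec f U \<noteq> 0"
proof -
  note D = indepKD[OF assms]
  have "f j \<noteq> 0" if "j \<in> U" for j using f a p that D(2) by force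
  then have "prod f U \<noteq> 0" using D(1) by simp
  moreover have "ldet (map g (sorted_list_of_set U)) \<noteq> 0"
    using ldet_nonzero_iff[of "sorted_list_of_set U" g] D by simp
  ultimately show ?thesis using assms by (simp add: crit_vec_def lsign_def)
qed

end

end

subsection \<open>The spectrum\<close>

lemma poly_funs_sum: "finite Z \<Longrightarrow> Z \<subseteq> {..<n} \<Longrightarrow> (\<lambda>a. \<Sum>j\<in>Z. a j) \<in> poly_funs n"
  by (induction Z rule: finite_induct) (auto intro: poly_funs.intros)

lemma poly_funs_prod:
  "finite I \<Longrightarrow> (\<And>i. i \<in> I \<Longrightarrow> P i \<in> poly_funs n) \<Longrightarrow> (\<lambda>a. \<Prod>i\<in>I. P i a) \<in> poly_funs n"
  by (induction I rule: finite_induct) (auto intro: poly_funs.intros)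

text \<open>Pairing \<open>p\<close> with the point of \<open>Y\<close> of parameter
  \<open>t\<close> evaluates the form with coefficient vector the sum of the
  \<open>p j *s g j\<close> at \<open>t\<close>; the unit vectors detect whether this form is
  zero.\<close>

lemma Yperp_iff:
  fixes g :: "nat \<Rightarrow> complex^'k"
  shows "p \<in> Yperp n g \<longleftrightarrow> p \<in> Cn n \<and> (\<Sum>j<n. p j *s g j) = 0"
proof -
  define y where "y t = (\<lambda>j. if j < n then \<Sum>i\<in>UNIV. t $ i * g j $ i else 0)" for t :: "complex^'k"
  have Y: "Ysp n g = range y"
    unfolding Ysp_def Cn_def y_def by (auto simp: fun_eq_iff not_less)
  have "(\<Sum>j<n. p j * y t j) = (\<Sum>i\<in>UNIV. t $ i * (\<Sum>j<n. p j *s g j) $ i)" for t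
    by (simp add: y_def sum_distrib_left mult_ac) (rule sum.swap)
  then have 1: "(\<forall>q\<in>Ysp n g. (\<Sum>j<n. p j * q j) = 0) \<longleftrightarrow>
      (\<forall>t::complex^'k. (\<Sum>i\<in>UNIV. t $ i * (\<Sum>j<n. p j *s g j) $ i) = 0)"
    unfolding Y by auto
  have "w = 0" if "\<forall>t::complex^'k. (\<Sum>i\<in>UNIV. t $ i * w $ i) = 0" for w :: "complex^'k"
  proof -
    have "w $ k = 0" for k
    proof -
      have "(\<Sum>i\<in>UNIV. axis k 1 $ i * w $ i) = (\<Sum>i\<in>UNIV. if i = k then w $ i else 0)"
        by (intro sum.cong) (auto simp: axis_def)
      then show ?thesis using that by simp
    qed
    then show ?thesis by (simp add: vec_eq_iff)
  qed
  then have "(\<forall>t::complex^'k. (\<Sum>i\<in>UNIV. t $ i * w $ i) = 0) \<longleftrightarrow> w = 0" for w :: "complex^'k"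
    by (intro iffI) simp_all
  from this[of "\<Sum>j<n. p j *s g j"] show ?thesis unfolding Yperp_def 1[symmetric] by blast
qed

lemma mem_LYa_iff:
  fixes g :: "nat \<Rightarrow> complex^'k"
  shows "(x, y) \<in> LYa n g a \<longleftrightarrow> x \<in> Cn n \<and> y \<in> Cn n \<and> (\<forall>j<n. y j \<noteq> 0) \<and> (\<Sum>j<n. y j *s g j) = 0 \<and>
    (\<exists>t::complex^'k. \<forall>j<n. x j = (\<Sum>i\<in>UNIV. t $ i * g j $ i) + a j / y j)"
proof
  assume "(x, y) \<in> LYa n g a"
  then show "x \<in> Cn n \<and> y \<in> Cn n \<and> (\<forall>j<n. y j \<noteq> 0) \<and> (\<Sum>j<n. y j *s g j) = 0 \<and>
    (\<exists>t::complex^'k. \<forall>j<n. x j = (\<Sum>i\<in>UNIV. t $ i * g j $ i) + a j / y j)"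
    unfolding LYa_def ra_def Yperp_iff Ysp_def by (auto simp: Cn_def)
next
  assume H: "x \<in> Cn n \<and> y \<in> Cn n \<and> (\<forall>j<n. y j \<noteq> 0) \<and> (\<Sum>j<n. y j *s g j) = 0 \<and>
    (\<exists>t::complex^'k. \<forall>j<n. x j = (\<Sum>i\<in>UNIV. t $ i * g j $ i) + a j / y j)"
  then obtain t :: "complex^'k" where t: "\<forall>j<n. x j = (\<Sum>i\<in>UNIV. t $ i * g j $ i) + a j / y j" by blast
  define q where "q = (\<lambda>j. if j < n then \<Sum>i\<in>UNIV. t $ i * g j $ i else 0)"
  have "q \<in> Ysp n g" unfolding Ysp_def q_def Cn_def by auto
  moreover have "(x, y) = ra n a (q, y)"
    using H t by (auto simp: ra_def q_def fun_eq_iff Cn_def)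
  ultimately show "(x, y) \<in> LYa n g a"
    unfolding LYa_def Yperp_iff using H by blast
qed

theorem theorem5p1:
  fixes n :: nat and g :: "nat \<Rightarrow> complex^'k" and lam :: "nat set \<Rightarrow> nat \<Rightarrow> complex"
  assumes "CARD('k) < n"
    and "\<forall>j<n. g j \<noteq> 0"
    and "\<forall>w::complex^'k. \<exists>c. w = (\<Sum>j<n. c j *s g j)"
    and "\<forall>C. circuit n g C \<longrightarrow>
           (\<forall>i. i \<notin> C \<longrightarrow> lam C i = 0) \<and> (\<exists>i. lam C i \<noteq> 0) \<and> (\<Sum>i\<in>C. lam C i *s g i) = 0"
  shows "\<exists>P\<in>poly_funs n. (\<exists>a\<in>torus n. P a \<noteq> 0) \<and>
           (\<forall>a\<in>torus n. P a \<noteq> 0 \<longrightarrow>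
              Spect n g lam a = LYa n g a \<inter> fst -` (Cn n - Delta n g lam))"
proof -
  interpret arrangement n g lam by unfold_locales (use assms(4) in blast)
  define F where "F = {Z. Z \<subseteq> {..<n} \<and> Z \<noteq> {}}"
  have F: "finite F" unfolding F_def by (rule finite_subset[of _ "Pow {..<n}"]) auto
  \<comment> \<open>\<open>P\<close> is nonzero exactly when all sums of weights over nonempty index
    sets are nonzero, the condition used to exclude zero eigenvalues.\<close>
  define P where "P a = (\<Prod>Z\<in>F. \<Sum>j\<in>Z. a j)" for a :: "nat \<Rightarrow> complex"
  have "P \<in> poly_funs n"
    unfolding P_def using F
    by (intro poly_funs_prod poly_funs_sum) (auto simp: F_def intro: finite_subset)
  moreover have "\<exists>a\<in>torus n. P a \<noteq> 0"
  proof
    \<comment> \<open>For unit weights these sums are cardinalities of nonempty sets.\<close>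
    define a :: "nat \<Rightarrow> complex" where "a = (\<lambda>j. if j < n then 1 else 0)"
    show "a \<in> torus n" by (simp add: torus_def Cn_def a_def)
    have "(\<Sum>j\<in>Z. a j) \<noteq> 0" if Z: "Z \<in> F" for Z
    proof -
      have "(\<Sum>j\<in>Z. a j) = (\<Sum>j\<in>Z. 1)" using Z by (intro sum.cong) (auto simp: F_def a_def)
      then show ?thesis using Z finite_subset[of Z "{..<n}"] by (auto simp: F_def)
    qed
    then show "P a \<noteq> 0" using F by (simp add: P_def)
  qed
  moreover have "(x, y) \<in> Spect n g lam a \<longleftrightarrow> (x, y) \<in> LYa n g a \<and> x \<in> Cn n - Delta n g lam"
    if tor: "a \<in> torus n" and Pa: "P a \<noteq> 0" for a x y
  proof
    have a: "a j \<noteq> 0" if "j < n" for j using tor that by (simp add: torus_def)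
    {
      assume "(x, y) \<in> Spect n g lam a"
      then obtain v where xy: "x \<in> Cn n - Delta n g lam" "y \<in> Cn n"
        and v: "v \<in> SingV n g a" "v \<noteq> (\<lambda>S. 0)"
        and "\<forall>j<n. Kop n g lam a j x v = (\<lambda>U. y j * v U)" unfolding Spect_def by blast
      then have eig: "Kop n g lam a j x v U = y j * v U" if "j < n" for j U using that by simp
      have nz: "fC lam n C x \<noteq> 0" if "circuit n g C" for C
        using xy that by (auto simp: Delta_def)
      obtain U where U: "v U \<noteq> 0" using v(2) by auto
      then have UK: "U \<in> indepK n g" using v(1) by (auto simp: SingV_def Vsp_def)
      have gen: "(\<Sum>j\<in>Z. a j) \<noteq> 0" if "Z \<subseteq> {..<n}" "Z \<noteq> {}" for Z
      proof -
        have "\<forall>Z\<in>F. (\<Sum>j\<in>Z. a j) \<noteq> 0" using Pa F by (simp add: P_def)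
        then show ?thesis using that unfolding F_def by blast
      qed
      have y: "y j \<noteq> 0" if "j < n" for j
        using eigen_nonzero[OF nz eig a gen v(1) UK U that] by blast
      obtain t :: "complex^'k" where "\<forall>j<n. x j = (\<Sum>i\<in>UNIV. t $ i * g j $ i) + a j / y j"
        by (rule eigen_point[OF nz eig y UK U])
      moreover have "(\<Sum>j<n. y j *s g j) = 0" by (rule eigen_relation[OF nz eig v(2)])
      ultimately show "(x, y) \<in> LYa n g a \<and> x \<in> Cn n - Delta n g lam"
        unfolding mem_LYa_iff using xy y by blast
    next
      assume H: "(x, y) \<in> LYa n g a \<and> x \<in> Cn n - Delta n g lam"
      then obtain t :: "complex^'k" where t: "\<And>j. j < n \<Longrightarrow> x j = (\<Sum>i\<in>UNIV. t $ i * g j $ i) + a j / y j"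
        and y: "y \<in> Cn n" "\<And>j. j < n \<Longrightarrow> y j \<noteq> 0" "(\<Sum>j<n. y j *s g j) = 0"
        unfolding mem_LYa_iff by blast
      have nz: "fC lam n C x \<noteq> 0" if "circuit n g C" for C
        using H that by (auto simp: Delta_def)
      let ?v = "crit_vec (\<lambda>j. a j / y j)"
      obtain U where U: "U \<in> indepK n g" using ex_indepK[OF assms(3)] .
      have "?v \<noteq> (\<lambda>S. 0)" using crit_vec_nonzero[OF y(2) a y(3) refl refl t U] by metis
      moreover have "?v \<in> SingV n g a" by (rule crit_vec_Sing[OF y(2) a y(3) refl refl t])
      moreover have "Kop n g lam a j x ?v U = y j * ?v U" if "j < n" for j U
        by (rule crit_vec_eigen[OF y(2) a y(3) refl refl t nz that])
      ultimately show "(x, y) \<in> Spect n g lam a"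
        unfolding Spect_def using H y(1) by (auto simp: fun_eq_iff)
    }
  qed
  ultimately show ?thesis by (intro bexI[of _ P]) auto
qed

end
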